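(* Let $U=U_1\times\cdots\times U_m$ be a Cartesian product of nonempty finite sets. Given a set $S\subseteq U$ (as a list of $m$-tuples), it can be decided in time polynomial in the size of the input, i.e. in $|S|$ and $m$, whether $S$ is ample.
   Context: A generalized partition of $U$ is a tuple $\Lambda=(\alpha_1,\dots,\alpha_m)$ with $\alpha_i$ a partition of $U_i$ into nonempty blocks; it defines a partition of $U$ into the boxes $P^1\times\cdots\times P^m$, $P^i\in\alpha_i$, and the minor-subproduct $M(\Lambda)=M_1\times\cdots\times M_m$, where $M_i$ is the set of blocks of $\alpha_i$. $M(\Lambda)$ is shattered by $S\subseteq U$ if $S$ meets every box of the box-partition. A copy of $M(\Lambda)$ is a set $W_1\times\cdots\times W_m$ where $W_i$ consists of exactly one element from each block of $\alpha_i$. $M(\Lambda)$ is strongly shattered by $S$ if $S$ contains a copy of it. $S$ is ample if every minor-subproduct of $U$ shattered by $S$ is strongly shattered by $S$. *)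

theory Defs
  imports "HOL-Computational_Algebra.Polynomial" "HOL-Library.Disjoint_Sets"
begin

text \<open>
  A product \<open>U\<^sub>1 \<times> \<dots> \<times> U\<^sub>m\<close> is represented by the list \<open>Us\<close> of its factors; its elements are the
  lists in \<^term>\<open>listset Us\<close>.  A generalized partition is a list of set systems \<open>\<Lambda>\<close>.  Its
  minor-subproduct is \<^term>\<open>listset \<Lambda>\<close>: a point of it is a list \<open>P\<close> of blocks, and the
  corresponding box of \<open>U\<close> is \<^term>\<open>listset P\<close>.
\<close>

definition generalized_partition :: "'a set list \<Rightarrow> 'a set set list \<Rightarrow> bool" where
  "generalized_partition Us \<Lambda> \<longleftrightarrow> list_all2 partition_on Us \<Lambda>"

definition minor_subproduct :: "'a set set list \<Rightarrow> 'a set list set" where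
  "minor_subproduct \<Lambda> = listset \<Lambda>"

definition shattered :: "'a list set \<Rightarrow> 'a set set list \<Rightarrow> bool" where
  "shattered S \<Lambda> \<longleftrightarrow> (\<forall>P\<in>minor_subproduct \<Lambda>. S \<inter> listset P \<noteq> {})"

definition transversal :: "'a set set \<Rightarrow> 'a set \<Rightarrow> bool" where
  "transversal \<alpha> W \<longleftrightarrow> W \<subseteq> \<Union>\<alpha> \<and> (\<forall>B\<in>\<alpha>. \<exists>!x. x \<in> W \<inter> B)"

definition copies :: "'a set set list \<Rightarrow> 'a list set set" where
  "copies \<Lambda> = {listset Ws | Ws. list_all2 transversal \<Lambda> Ws}"

definition strongly_shattered :: "'a list set \<Rightarrow> 'a set set list \<Rightarrow> bool" where
  "strongly_shattered S \<Lambda> \<longleftrightarrow> (\<exists>C\<in>copies \<Lambda>. C \<subseteq> S)"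

definition ample :: "'a set list \<Rightarrow> 'a list set \<Rightarrow> bool" where
  "ample Us S \<longleftrightarrow>
     (\<forall>\<Lambda>. generalized_partition Us \<Lambda> \<longrightarrow> shattered S \<Lambda> \<longrightarrow> strongly_shattered S \<Lambda>)"

text \<open>
  The machine model is Jones' WHILE language: structured programs over finitely many variables that
  hold binary trees (pointers to immutable cells), every elementary operation having unit cost.
  Its polynomial time coincides with that of Turing machines.  The coordinates of tuples are
  uninterpreted atoms: programs cannot mention a particular atom, and all they can do with atoms
  is copy them and compare two of them.  Since subtrees may be shared, a tree
  can have size exponential in the number of steps spent on building it; therefore the comparison
  \<open>Same\<close> only inspects the roots, and it fails on inner nodes, so that every operation is
  honestly of unit cost.
\<close>

datatype 'a tree = Leaf | Atom 'a | Node "'a tree" "'a tree"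

fun left :: "'a tree \<Rightarrow> 'a tree" where
  "left (Node l r) = l"
| "left Leaf = Leaf"
| "left (Atom a) = Leaf"

fun right :: "'a tree \<Rightarrow> 'a tree" where
  "right (Node l r) = r"
| "right Leaf = Leaf"
| "right (Atom a) = Leaf"

text \<open>\<^const>\<open>Leaf\<close> represents falsity; all other trees represent truth.\<close>

fun same :: "'a tree \<Rightarrow> 'a tree \<Rightarrow> 'a tree" where
  "same Leaf Leaf = Node Leaf Leaf"
| "same (Atom a) (Atom b) = (if a = b then Node Leaf Leaf else Leaf)"
| "same _ _ = Leaf"

datatype expr = Var nat | Empty | Join expr expr | Left expr | Right expr | Same expr expr

datatype com =
    Skip
  | Assign nat expr
  | Seq com com
  | Cond expr com com
  | While expr com

type_synonym 'a state = "nat \<Rightarrow> 'a tree"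

fun eval_expr :: "expr \<Rightarrow> 'a state \<Rightarrow> 'a tree" where
  "eval_expr (Var x) s = s x"
| "eval_expr Empty s = Leaf"
| "eval_expr (Join e f) s = Node (eval_expr e s) (eval_expr f s)"
| "eval_expr (Left e) s = left (eval_expr e s)"
| "eval_expr (Right e) s = right (eval_expr e s)"
| "eval_expr (Same e f) s = same (eval_expr e s) (eval_expr f s)"

fun cost :: "expr \<Rightarrow> nat" where
  "cost (Var x) = 1"
| "cost Empty = 1"
| "cost (Join e f) = 1 + cost e + cost f"
| "cost (Left e) = 1 + cost e"
| "cost (Right e) = 1 + cost e"
| "cost (Same e f) = 1 + cost e + cost f"

text \<open>\<open>exec c s t s'\<close>: started in state \<open>s\<close>, program \<open>c\<close> halts in state \<open>s'\<close> after exactly \<open>t\<close> steps.\<close>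

inductive exec :: "com \<Rightarrow> 'a state \<Rightarrow> nat \<Rightarrow> 'a state \<Rightarrow> bool" where
  Skip: "exec Skip s 1 s"
| Assign: "exec (Assign x e) s (1 + cost e) (s(x := eval_expr e s))"
| Seq: "exec c s t s' \<Longrightarrow> exec d s' u s'' \<Longrightarrow> exec (Seq c d) s (1 + t + u) s''"
| Cond_true: "eval_expr e s \<noteq> Leaf \<Longrightarrow> exec c s t s' \<Longrightarrow> exec (Cond e c d) s (1 + cost e + t) s'"
| Cond_false: "eval_expr e s = Leaf \<Longrightarrow> exec d s t s' \<Longrightarrow> exec (Cond e c d) s (1 + cost e + t) s'"
| While_false: "eval_expr e s = Leaf \<Longrightarrow> exec (While e c) s (1 + cost e) s"
| While_true: "eval_expr e s \<noteq> Leaf \<Longrightarrow> exec c s t s' \<Longrightarrow> exec (While e c) s' u s''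
    \<Longrightarrow> exec (While e c) s (1 + cost e + t + u) s''"

inductive_cases exec_SkipE: "exec Skip s t s'"
inductive_cases exec_AssignE: "exec (Assign x e) s t s'"
inductive_cases exec_SeqE: "exec (Seq c d) s t s'"
inductive_cases exec_CondE: "exec (Cond e c d) s t s'"
inductive_cases exec_WhileE: "exec (While e c) s t s'"

lemma exec_deterministic:
  "exec c s t s' \<Longrightarrow> exec c s u s'' \<Longrightarrow> u = t \<and> s'' = s'"
proof (induction arbitrary: u s'' rule: exec.induct)
  case (Skip s)
  from Skip.prems show ?case by (rule exec_SkipE) simp
next
  case (Assign x e s)
  from Assign.prems show ?case by (rule exec_AssignE) simp
next
  case (Seq c s t s' d v s1)
  from Seq.prems show ?case by (rule exec_SeqE) (auto dest!: Seq.IH)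
next
  case (Cond_true e s c t s' d)
  from Cond_true.prems show ?case by (rule exec_CondE) (auto simp: Cond_true.hyps dest!: Cond_true.IH)
next
  case (Cond_false e s d t s' c)
  from Cond_false.prems show ?case by (rule exec_CondE) (auto simp: Cond_false.hyps dest!: Cond_false.IH)
next
  case (While_false e s c)
  from While_false.prems show ?case by (rule exec_WhileE) (auto simp: While_false.hyps)
next
  case (While_true e s c t s' v s1)
  from While_true.prems show ?case
    by (rule exec_WhileE) (auto simp: While_true.hyps dest!: While_true.IH)
qed

text \<open>Input is passed in variable 0, all other variables being empty, and the answer is read off variable 0.\<close>

definition decides_within :: "com \<Rightarrow> 'a tree \<Rightarrow> nat \<Rightarrow> bool \<Rightarrow> bool" where
  "decides_within c inp T b \<longleftrightarrow>
     (\<exists>t s. exec c ((\<lambda>_. Leaf)(0 := inp)) t s \<and> t \<le> T \<and> (s 0 \<noteq> Leaf \<longleftrightarrow> b))"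

definition tree_of_list :: "('b \<Rightarrow> 'a tree) \<Rightarrow> 'b list \<Rightarrow> 'a tree" where
  "tree_of_list f xs = foldr (\<lambda>x t. Node (f x) t) xs Leaf"

definition tree_of_tuples :: "'a list list \<Rightarrow> 'a tree" where
  "tree_of_tuples = tree_of_list (tree_of_list Atom)"

end

theory Submission
  imports Defs
begin

text \<open>
  A set is ample iff any two parallel cubes contained in it are joined, inside it, by a shortest gallery
  of parallel cubes.  Given galleries, a fiber over one coordinate is found by induction: if the
  fibers of \<open>S\<close> over a set of values cover a box then one of them does, and fibers over several values
  that all meet a box have a common point in it.  Conversely, two cubes without the first step of a gallery
  give a shattered minor-subproduct that is not strongly shattered.

  The gallery condition is first-order: a cube is determined by two antipodal vertices in \<open>S\<close>,
  parallel cubes by four, and whether the cube is contained in \<open>S\<close> can again be expressed by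
  quantification over \<open>S\<close>.  Such a sentence is evaluated by nested loops over the input list.
\<close>

section \<open>Betweenness and a Helly property\<close>

text \<open>Partitions of the factors are too many to be searched. The gallery condition speaks of
  cubes only, and asking for one step instead of a whole gallery keeps the number of quantified
  vertices fixed. The price is that a copy of a minor-subproduct has to be assembled one coordinate
  at a time: once a value is chosen in each block of the first factor, the rest of the copy must lie
  in the fibers over all these values at once. So galleries have to be inherited by projections, and
  by fibers over arbitrary finite nonempty sets of values instead of pairs only. In the resulting
  sentence seven quantifiers are nested, four for the antipodes of two cubes and three inside the
  conditions on them; with the scan of the coordinates this gives a polynomial of degree
  eight.\<close>

definition between :: "'b list \<Rightarrow> 'b list \<Rightarrow> 'b list \<Rightarrow> bool" where
  "between x z y \<longleftrightarrow> length z = length x \<and> length y = length x \<and>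
     (\<forall>i<length x. z ! i = x ! i \<or> z ! i = y ! i)"

text \<open>Like \<open>between\<close>, this is used at two types: for points of the product, and
  for boxes as lists of sides. For two parallel cubes it is the length of a shortest gallery in the
  full product, and the cubes between them are those that such a gallery can visit.\<close>

definition hdist :: "'b list \<Rightarrow> 'b list \<Rightarrow> nat" where
  "hdist x y = card {i. i < length x \<and> x ! i \<noteq> y ! i}"

lemma between_refl: "length y = length x \<Longrightarrow> between x x y" "length y = length x \<Longrightarrow> between x y y"
  by (auto simp: between_def)

lemma between_sym: "between x z y \<Longrightarrow> between y z x"
  by (auto simp: between_def)

lemma between_convex: "between x u y \<Longrightarrow> between x v y \<Longrightarrow> between u z v \<Longrightarrow> between x z y"
  unfolding between_def by (metis (no_types))

lemma between_trans: "between x z y \<Longrightarrow> between x u z \<Longrightarrow> between x u y"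
  by (rule between_convex[of x x y z]) (auto simp: between_def)

lemma between_antisym: "between x z y \<Longrightarrow> between x y z \<Longrightarrow> y = z"
  unfolding between_def by (intro nth_equalityI) metis+

lemma between_update: "length y = length x \<Longrightarrow> between x (x[i := y ! i]) y"
  by (cases "i < length x") (auto simp: between_def nth_list_update)

lemma hdist_less:
  assumes "between x z y" "z \<noteq> y"
  shows "hdist x z < hdist x y"
proof -
  obtain k where "k < length x" "z ! k \<noteq> y ! k"
    using assms unfolding between_def by (metis nth_equalityI)
  note k = this
  have eq: "z ! i = x ! i \<or> z ! i = y ! i" if "i < length x" for i
    using assms(1) that unfolding between_def by blast
  have "{i. i < length x \<and> x ! i \<noteq> z ! i} \<subseteq> {i. i < length x \<and> x ! i \<noteq> y ! i}"
    using eq by force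
  moreover have "k \<notin> {i. i < length x \<and> x ! i \<noteq> z ! i}" "k \<in> {i. i < length x \<and> x ! i \<noteq> y ! i}"
    using k eq[of k] by auto
  ultimately have "{i. i < length x \<and> x ! i \<noteq> z ! i} \<subset> {i. i < length x \<and> x ! i \<noteq> y ! i}"
    by blast
  then show ?thesis unfolding hdist_def by (intro psubset_card_mono) auto
qed

lemma hdist_sym: "length x = length y \<Longrightarrow> hdist x y = hdist y x"
  unfolding hdist_def by (metis (mono_tags, lifting))

lemma hdist_less':
  assumes "between x z y" "z \<noteq> x"
  shows "hdist z y < hdist x y"
proof -
  have "hdist y z < hdist y x" using assms between_sym hdist_less by blast
  then show ?thesis using assms by (simp add: hdist_sym between_def)
qed

lemma obtain_three:
  assumes "\<And>a b. X \<noteq> {a, b}" "X \<noteq> {}"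
  obtains a b c where "a \<in> X" "b \<in> X" "c \<in> X" "a \<noteq> b" "a \<noteq> c" "b \<noteq> c"
proof -
  obtain a where "a \<in> X" using assms by blast
  moreover obtain b where "b \<in> X" "b \<noteq> a" using assms(1)[of a a] \<open>a \<in> X\<close> by blast
  moreover obtain c where "c \<in> X" "c \<noteq> a" "c \<noteq> b" using assms(1)[of a b] \<open>a \<in> X\<close> \<open>b \<in> X\<close> by blast
  ultimately show thesis using that by metis
qed

text \<open>The induction removes one index at a time: among the points lying in all sets but one
  (for two different omitted indices), a closest pair must coincide with a common point.\<close>

lemma helly:
  fixes F :: "'i \<Rightarrow> 'b list set"
  assumes "finite X" "X \<noteq> {}"
    and "\<And>a b x y. a \<in> X \<Longrightarrow> b \<in> X \<Longrightarrow> x \<in> F a \<Longrightarrow> y \<in> F b \<Longrightarrow> \<exists>z. between x z y \<and> z \<in> F a \<and> z \<in> F b"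
    and "\<And>x y z. x \<in> R \<Longrightarrow> y \<in> R \<Longrightarrow> between x z y \<Longrightarrow> z \<in> R"
    and "\<And>a. a \<in> X \<Longrightarrow> \<exists>x. x \<in> F a \<and> x \<in> R"
  shows "\<exists>z\<in>R. \<forall>a\<in>X. z \<in> F a"
  using assms
proof (induction X arbitrary: R rule: finite_psubset_induct)
  case (psubset X)
  note sw = psubset.prems(2) and conv = psubset.prems(3) and meets = psubset.prems(4)
  have IH: "\<exists>z\<in>Q. \<forall>a\<in>Y. z \<in> F a"
    if "Y \<subset> X" "Y \<noteq> {}" "\<And>x y z. x \<in> Q \<Longrightarrow> y \<in> Q \<Longrightarrow> between x z y \<Longrightarrow> z \<in> Q"
      "\<And>a. a \<in> Y \<Longrightarrow> \<exists>x. x \<in> F a \<and> x \<in> Q" for Y Q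
  proof (rule psubset.IH[OF that(1,2)])
    show "\<exists>z. between x z y \<and> z \<in> F a \<and> z \<in> F b"
      if "a \<in> Y" "b \<in> Y" "x \<in> F a" "y \<in> F b" for a b x y
      using sw[OF _ _ that(3,4)] that(1,2) \<open>Y \<subset> X\<close> by blast
  qed (use that in blast)+
  show ?case
  proof (cases "\<exists>a b. X = {a, b}")
    case True
    then obtain a b where X: "X = {a, b}" by blast
    obtain x y where "x \<in> F a" "x \<in> R" "y \<in> F b" "y \<in> R" using meets X by blast
    then show ?thesis using sw[of a b x y] conv X by blast
  next
    case False
    then obtain a b c where abc: "a \<in> X" "b \<in> X" "c \<in> X" "a \<noteq> b" "a \<noteq> c" "b \<noteq> c"
      using obtain_three[of X] psubset.prems(1) by (metis (no_types))
    define G where "G d = {z \<in> R. \<forall>e\<in>X - {d}. z \<in> F e}" for d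
    have G: "\<exists>z. z \<in> G d" if "d \<in> X" for d
      using IH[of "X - {d}" R] that abc conv meets unfolding G_def by blast
    define C where "C = (\<lambda>(x, y). x \<in> G b \<and> y \<in> G a)"
    obtain u v where "u \<in> G b" "v \<in> G a" using G abc by blast
    then have "C (u, v)" by (simp add: C_def)
    then obtain xy where "C xy" "\<forall>uv. C uv \<longrightarrow> (\<lambda>(x, y). hdist x y) xy \<le> (\<lambda>(x, y). hdist x y) uv"
      using ex_has_least_nat[of C _ "\<lambda>(x, y). hdist x y"] by blast
    then obtain x y where x: "x \<in> G b" and y: "y \<in> G a"
      and least: "\<And>u v. u \<in> G b \<Longrightarrow> v \<in> G a \<Longrightarrow> hdist x y \<le> hdist u v"
      unfolding C_def by (cases xy) auto
    have len: "length y = length x"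
      using x y abc sw[of c c x y] unfolding G_def between_def by blast
    have meet1: "\<exists>w. w \<in> F d \<and> w \<in> {w. between x w y}" if d: "d \<in> X - {c}" for d
    proof (cases "d = b")
      case True
      then have "y \<in> F d" using y d abc unfolding G_def by blast
      then show ?thesis using len between_refl by blast
    next
      case False
      then have "x \<in> F d" using x d abc unfolding G_def by blast
      then show ?thesis using len between_refl by blast
    qed
    \<comment> \<open>Every set except the one of index \<open>c\<close> contains an end of the
      interval from \<open>x\<close> to \<open>y\<close>: the set of \<open>b\<close> contains
      \<open>y\<close>, the others contain \<open>x\<close>. Intervals are convex, so the induction
      hypothesis applies with the interval as region.\<close>
    have "\<exists>z\<in>{w. between x w y}. \<forall>d\<in>X - {c}. z \<in> F d"
    proof (rule IH)
      show "w \<in> {w. between x w y}" if "u \<in> {w. between x w y}" "v \<in> {w. between x w y}" "between u w v" for u v w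
        using between_convex that by blast
    qed (use abc meet1 in blast)+
    then obtain z where z: "between x z y" "\<And>d. d \<in> X \<Longrightarrow> d \<noteq> c \<Longrightarrow> z \<in> F d" by blast
    have meet2: "\<exists>w. w \<in> F d \<and> w \<in> {w. between x w z}" if d: "d \<in> X - {a}" for d
    proof (cases "d = c")
      case True
      then have "x \<in> F d" using x d abc unfolding G_def by blast
      then show ?thesis using z(1) between_refl unfolding between_def by blast
    next
      case False
      then have "z \<in> F d" using z(2) d by blast
      then show ?thesis using z(1) between_refl(2)[of z x] unfolding between_def by blast
    qed
    have "\<exists>u\<in>{w. between x w z}. \<forall>d\<in>X - {a}. u \<in> F d"
    proof (rule IH)
      show "w \<in> {w. between x w z}" if "u \<in> {w. between x w z}" "v \<in> {w. between x w z}" "between u w v" for u v w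
        using between_convex that by blast
    qed (use abc meet2 in blast)+
    then obtain u where u: "between x u z" "\<And>d. d \<in> X \<Longrightarrow> d \<noteq> a \<Longrightarrow> u \<in> F d" by blast
    have xyR: "x \<in> R" "y \<in> R" using x y unfolding G_def by auto
    have "between x u y" using between_trans[OF z(1) u(1)] .
    then have "u \<in> G a" using u(2) xyR conv[of x y u] unfolding G_def by blast
    \<comment> \<open>Otherwise \<open>u\<close> would replace \<open>y\<close> in a closer pair. As
      \<open>u\<close> lies between \<open>x\<close> and \<open>z\<close>, and \<open>z\<close>
      between \<open>x\<close> and \<open>y\<close>, this squeezes \<open>z\<close> onto
      \<open>y\<close>.\<close>
    then have "u = y" using least[OF x, of u] hdist_less[OF \<open>between x u y\<close>] by force
    then have "y = z" using between_antisym[OF z(1)] u(1) by blast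
    then have "\<forall>d\<in>X. y \<in> F d" using z(2) y abc unfolding G_def by blast
    then show ?thesis using xyR by blast
  qed
qed

section \<open>Boxes, parallel cubes and galleries\<close>

lemma mem_listset: "x \<in> listset A \<longleftrightarrow> length x = length A \<and> (\<forall>i<length A. x ! i \<in> A ! i)"
proof (induction A arbitrary: x)
  case (Cons X A)
  show ?case
    by (cases x) (auto simp: Cons.IH set_Cons_def less_Suc_eq_0_disj)
qed auto

lemma listset_singletons: "listset (map (\<lambda>u. {u}) z) = {z}"
  by (auto simp: mem_listset list_eq_iff_nth_eq)

definition small_box :: "'a set list \<Rightarrow> bool" where
  "small_box A \<longleftrightarrow> (\<forall>X\<in>set A. \<exists>a b. X = {a, b})"

text \<open>For cubes, this means being translates along coordinates in which both are constant: a
  side with two elements has to be shared.\<close>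

definition parallel :: "'a set list \<Rightarrow> 'a set list \<Rightarrow> bool" where
  "parallel A B \<longleftrightarrow> length B = length A \<and>
     (\<forall>i<length A. A ! i = B ! i \<or> (\<exists>x y. A ! i = {x} \<and> B ! i = {y}))"

text \<open>Boxes whose sides have at most two elements are the cubes of the Hamming graph.  Two parallel
  cubes inside \<open>S\<close> must be joined by a gallery of parallel cubes of \<open>S\<close> that is as short as possible;
  it suffices to ask for its first step.\<close>

definition galleries :: "'a list set \<Rightarrow> bool" where
  "galleries S \<longleftrightarrow> (\<forall>A B. small_box A \<longrightarrow> parallel A B \<longrightarrow> listset A \<subseteq> S \<longrightarrow> listset B \<subseteq> S \<longrightarrow> A \<noteq> B \<longrightarrow>
     (\<exists>i<length A. A ! i \<noteq> B ! i \<and> listset (A[i := B ! i]) \<subseteq> S))"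

lemma galleriesD:
  assumes "galleries S" "small_box A" "parallel A B" "listset A \<subseteq> S" "listset B \<subseteq> S" "A \<noteq> B"
  obtains i where "i < length A" "A ! i \<noteq> B ! i" "listset (A[i := B ! i]) \<subseteq> S"
  using assms unfolding galleries_def by blast

lemma parallel_btw: "parallel A B \<Longrightarrow> between A C B \<Longrightarrow> parallel A C \<and> parallel C B"
  unfolding parallel_def between_def by metis

lemma parallel_convex:
  assumes "parallel A B" "parallel A C" "between B D C" shows "parallel A D"
  using assms unfolding parallel_def between_def by metis

lemma parallel_sym: "parallel A B \<Longrightarrow> parallel B A"
  unfolding parallel_def by metis

lemma small_box_par: "small_box A \<Longrightarrow> parallel A B \<Longrightarrow> small_box B"
  unfolding parallel_def small_box_def by (metis in_set_conv_nth insert_absorb2)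

lemma parallel_Cons [simp]: "parallel (X # A) (Y # B) \<longleftrightarrow> (X = Y \<or> (\<exists>x y. X = {x} \<and> Y = {y})) \<and> parallel A B"
  unfolding parallel_def by (auto simp: less_Suc_eq_0_disj)

lemma small_box_Cons [simp]: "small_box (X # A) \<longleftrightarrow> (\<exists>a b. X = {a, b}) \<and> small_box A"
  unfolding small_box_def by auto

definition fiber :: "'a list set \<Rightarrow> 'a set \<Rightarrow> 'a list set" where
  "fiber S X = {x. \<forall>a\<in>X. a # x \<in> S}"

lemma listset_Cons_subset: "listset (X # A) \<subseteq> S \<longleftrightarrow> listset A \<subseteq> fiber S X"
  by (auto simp: set_Cons_def fiber_def)

lemma pair_singleton: "\<exists>c d. {a} = {c, d}" by blast

text \<open>A gallery from \<open>{a} # A\<close> to \<open>{b} # B\<close> has to change the first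
  side at some moment; the other sides at that moment form the cube \<open>C\<close>, which
  therefore lies in both fibers. All earlier steps stay in the fiber over \<open>a\<close> and bring
  \<open>A\<close> closer to \<open>B\<close>.\<close>

lemma switch:
  assumes "galleries S" "small_box A" "parallel A B" "listset A \<subseteq> fiber S {a}" "listset B \<subseteq> fiber S {b}"
  shows "\<exists>C. between A C B \<and> listset C \<subseteq> fiber S {a} \<and> listset C \<subseteq> fiber S {b}"
proof (cases "a = b")
  case True
  have "between A A B" using assms(3) by (auto simp: parallel_def between_def)
  then show ?thesis using assms True by blast
next
  case ab: False
  show ?thesis using assms(2-5)
  proof (induction "hdist A B" arbitrary: A rule: less_induct)
    case less
    have len: "length B = length A" using less.prems by (simp add: parallel_def)
    have "small_box ({a} # A)" "parallel ({a} # A) ({b} # B)" using less.prems pair_singleton by auto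
    then obtain i where i: "i < length ({a} # A)" "({a} # A) ! i \<noteq> ({b} # B) ! i"
      "listset (({a} # A)[i := ({b} # B) ! i]) \<subseteq> S"
      using galleriesD[OF assms(1), of "{a} # A" "{b} # B"] less.prems ab by (auto simp only: listset_Cons_subset)
    show ?case
    proof (cases i)
      case 0
      then have "listset A \<subseteq> fiber S {b}" using i(3) by (simp only: listset_Cons_subset nth_Cons_0 list_update_code)
      then show ?thesis using less.prems between_refl[OF len] by blast
    next
      case (Suc j)
      let ?A = "A[j := B ! j]"
      have sub: "listset ?A \<subseteq> fiber S {a}"
        using i(3) Suc by (simp only: listset_Cons_subset nth_Cons_Suc list_update_code)
      have bt: "between A ?A B" using len by (rule between_update)
      have ne: "?A \<noteq> A" using i Suc by (metis Suc_less_eq length_Cons nth_Cons_Suc nth_list_update_eq)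
      have "\<exists>C. between ?A C B \<and> listset C \<subseteq> fiber S {a} \<and> listset C \<subseteq> fiber S {b}"
        using hdist_less'[OF bt ne] sub less.prems parallel_btw[OF _ bt] small_box_par by (intro less.hyps) blast+
      then show ?thesis using between_convex[OF bt between_refl(2)[OF len]] by blast
    qed
  qed
qed

section \<open>Fibers and projections\<close>

lemma listset_update_subset: "i < length A \<Longrightarrow> X \<subseteq> A ! i \<Longrightarrow> listset (A[i := X]) \<subseteq> listset A"
  by (force simp: mem_listset nth_list_update split: if_splits)

text \<open>The interval between two points, as a box. Coordinates where they agree give singleton
  sides, so any two points of equal length are antipodes of the cube that they span.\<close>

definition subcube :: "'a list \<Rightarrow> 'a list \<Rightarrow> 'a set list" where
  "subcube p q = map2 (\<lambda>a b. {a, b}) p q"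

lemma length_subcube [simp]: "length (subcube p q) = min (length p) (length q)"
  by (simp add: subcube_def)

lemma nth_subcube [simp]: "i < length p \<Longrightarrow> i < length q \<Longrightarrow> subcube p q ! i = {p ! i, q ! i}"
  by (simp add: subcube_def)

lemma mem_subcube: "length p = length q \<Longrightarrow> x \<in> listset (subcube p q) \<longleftrightarrow> between p x q"
  by (auto simp: mem_listset between_def)

lemma parallel_between:
  assumes "parallel A B" "between A C B" "between A D B" shows "parallel C D"
proof -
  have "C ! i = D ! i \<or> (\<exists>x y. C ! i = {x} \<and> D ! i = {y})" if "i < length A" for i
  proof -
    have "C ! i = A ! i \<or> C ! i = B ! i" "D ! i = A ! i \<or> D ! i = B ! i"
      "A ! i = B ! i \<or> (\<exists>x y. A ! i = {x} \<and> B ! i = {y})"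
      using assms that unfolding parallel_def between_def by blast+
    then show ?thesis by metis
  qed
  then show ?thesis using assms unfolding parallel_def between_def by simp
qed

lemma small_box_update:
  assumes "small_box A" "\<exists>a b. X = {a, b}" shows "small_box (A[i := X])"
  unfolding small_box_def
proof
  fix Y assume "Y \<in> set (A[i := X])"
  then have "Y = X \<or> Y \<in> set A" using set_update_subset_insert[of A i X] by blast
  then show "\<exists>a b. Y = {a, b}" using assms unfolding small_box_def by blast
qed

text \<open>If both fibers miss points of \<open>W\<close>, a closest pair of missed points makes \<open>S\<close> restricted to the
  cube they span a cube without two antipodes, and that set has no galleries.\<close>

lemma two_fibers:
  assumes "galleries S" "a \<noteq> b" "\<And>w. w \<in> listset W \<Longrightarrow> a # w \<in> S \<or> b # w \<in> S"
  shows "listset W \<subseteq> fiber S {a} \<or> listset W \<subseteq> fiber S {b}"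
proof (rule ccontr)
  assume "\<not> ?thesis"
  then obtain u v where uv: "u \<in> listset W" "a # u \<notin> S" "v \<in> listset W" "b # v \<notin> S"
    unfolding fiber_def by blast
  define C where "C = (\<lambda>(x, y). x \<in> listset W \<and> y \<in> listset W \<and> a # x \<notin> S \<and> b # y \<notin> S)"
  have "C (u, v)" using uv by (simp add: C_def)
  then obtain xy where "C xy" "\<forall>uv. C uv \<longrightarrow> (\<lambda>(x, y). hdist x y) xy \<le> (\<lambda>(x, y). hdist x y) uv"
    using ex_has_least_nat[of C _ "\<lambda>(x, y). hdist x y"] by blast
  then obtain x y where x: "x \<in> listset W" "a # x \<notin> S" and y: "y \<in> listset W" "b # y \<notin> S"
    and least: "\<And>u v. u \<in> listset W \<Longrightarrow> v \<in> listset W \<Longrightarrow> a # u \<notin> S \<Longrightarrow> b # v \<notin> S \<Longrightarrow> hdist x y \<le> hdist u v"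
    unfolding C_def by (cases xy) auto
  have len: "length x = length W" "length y = length W" using x y by (auto simp: mem_listset)
  have sub: "z \<in> listset W" if "between x z y" for z
    using that x(1) y(1) by (auto simp: mem_listset between_def)
  \<comment> \<open>By minimality of the pair, \<open>x\<close> is the only point of the interval
    that the fiber over \<open>a\<close> misses, and \<open>y\<close> the only one that the fiber
    over \<open>b\<close> misses.\<close>
  have inA: "a # z \<in> S" if "between x z y" "z \<noteq> x" for z
    using least[OF sub[OF that(1)] y(1) _ y(2)] hdist_less'[OF that] by auto
  have inB: "b # z \<in> S" if "between x z y" "z \<noteq> y" for z
    using least[OF x(1) sub[OF that(1)] x(2)] hdist_less[OF that] by auto
  have "x \<noteq> y" using assms(3) x y by blast
  then obtain j where j: "j < length W" "x ! j \<noteq> y ! j" using len by (metis nth_equalityI)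
  let ?Q = "subcube x y"
  have Q: "length ?Q = length W" "small_box ?Q" using len by (auto simp: small_box_def in_set_conv_nth, blast)
  \<comment> \<open>The two halves of the spanned cube in direction \<open>j\<close>: the half
    through \<open>y\<close> avoids \<open>x\<close> and lies in the fiber over \<open>a\<close>,
    the half through \<open>x\<close> avoids \<open>y\<close> and lies in the fiber over
    \<open>b\<close>.\<close>
  define A where "A = {a} # ?Q[j := {y ! j}]"
  define B where "B = {b} # ?Q[j := {x ! j}]"
  have "small_box (?Q[j := {y ! j}])"
    using small_box_update[OF Q(2)] by blast
  moreover have "parallel (?Q[j := {y ! j}]) (?Q[j := {x ! j}])"
    using Q j by (auto simp: parallel_def nth_list_update simp del: nth_subcube)
  ultimately have AB: "small_box A" "parallel A B"
    using pair_singleton unfolding A_def B_def by auto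
  have A: "listset A \<subseteq> S"
  proof -
    have "a # z \<in> S" if "z \<in> listset (?Q[j := {y ! j}])" for z
    proof (rule inA)
      show "between x z y" using that listset_update_subset[of j ?Q "{y ! j}"] j len mem_subcube[of x y z] by auto
      show "z \<noteq> x" using that j len by (auto simp: mem_listset)
    qed
    then show ?thesis unfolding A_def listset_Cons_subset fiber_def by blast
  qed
  have B: "listset B \<subseteq> S"
  proof -
    have "b # z \<in> S" if "z \<in> listset (?Q[j := {x ! j}])" for z
    proof (rule inB)
      show "between x z y" using that listset_update_subset[of j ?Q "{x ! j}"] j len mem_subcube[of x y z] by auto
      show "z \<noteq> y" using that j len by (auto simp: mem_listset)
    qed
    then show ?thesis unfolding B_def listset_Cons_subset fiber_def by blast
  qed
  have "A \<noteq> B" using assms(2) unfolding A_def B_def by simp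
  then obtain i where i: "i < length A" "A ! i \<noteq> B ! i" "listset (A[i := B ! i]) \<subseteq> S"
    using galleriesD[OF assms(1) AB A B] by blast
  \<comment> \<open>Both possible steps fail: changing the first side would put \<open>y\<close>
    into the fiber over \<open>b\<close>, changing side \<open>j\<close> of the cube would put
    \<open>x\<close> into the fiber over \<open>a\<close>.\<close>
  show False
  proof (cases i)
    case 0
    then have "listset (?Q[j := {y ! j}]) \<subseteq> fiber S {b}"
      using i(3) unfolding A_def B_def by (simp only: nth_Cons_0 list_update_code listset_Cons_subset)
    moreover have "y \<in> listset (?Q[j := {y ! j}])" using len j by (auto simp: mem_listset nth_list_update)
    ultimately show False using y unfolding fiber_def by blast
  next
    case (Suc k)
    then have k: "k < length W" "?Q[j := {y ! j}] ! k \<noteq> ?Q[j := {x ! j}] ! k"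
      using i len unfolding A_def B_def by auto
    then have kj: "k = j" using len by (metis nth_list_update_neq)
    then have "A[i := B ! i] = {a} # ?Q[j := {x ! j}]"
      unfolding A_def B_def Suc using Q j by simp
    then have "listset (?Q[j := {x ! j}]) \<subseteq> fiber S {a}" using i(3) by (simp only: listset_Cons_subset)
    moreover have "x \<in> listset (?Q[j := {x ! j}])" using len j by (auto simp: mem_listset nth_list_update)
    ultimately show False using x unfolding fiber_def by blast
  qed
qed

text \<open>Induction on the total size of the sides: a side with several elements splits into a
  point and the rest, each part of the box lies in a single fiber, and \<open>two_fibers\<close>
  finds one fiber for both parts. If no side splits, the box is a single point.\<close>

lemma fiber_cover:
  assumes "galleries S" "\<And>X. X \<in> set W \<Longrightarrow> finite X \<and> X \<noteq> {}"
    and "\<And>w. w \<in> listset W \<Longrightarrow> \<exists>a\<in>D. a # w \<in> S"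
  shows "\<exists>a\<in>D. listset W \<subseteq> fiber S {a}"
  using assms(2,3)
proof (induction "sum_list (map card W)" arbitrary: W rule: less_induct)
  case less
  show ?case
  proof (cases "\<exists>j<length W. \<exists>c\<in>W ! j. W ! j \<noteq> {c}")
    case True
    then obtain j c where j: "j < length W" "c \<in> W ! j" "W ! j \<noteq> {c}" by blast
    have fin: "finite (W ! j)" using less.prems(1) j by auto
    have rec: "\<exists>a\<in>D. listset (W[j := Y]) \<subseteq> fiber S {a}" if Y: "Y \<subset> W ! j" "Y \<noteq> {}" for Y
    proof (rule less.hyps)
      have "card Y < card (W ! j)" using Y fin by (simp add: psubset_card_mono)
      moreover have "map card W ! j \<le> sum_list (map card W)" using j by (intro elem_le_sum_list) auto
      ultimately show "sum_list (map card (W[j := Y])) < sum_list (map card W)"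
        using j by (simp add: map_update sum_list_update)
      show "finite X \<and> X \<noteq> {}" if "X \<in> set (W[j := Y])" for X
      proof -
        have "X = Y \<or> X \<in> set W" using that set_update_subset_insert[of W j Y] by blast
        then show ?thesis using less.prems(1) Y finite_subset[OF _ fin] by blast
      qed
      show "\<exists>a\<in>D. a # w \<in> S" if "w \<in> listset (W[j := Y])" for w
        using that less.prems(2) listset_update_subset[of j W Y] Y j by blast
    qed
    obtain a where a: "a \<in> D" "listset (W[j := {c}]) \<subseteq> fiber S {a}" using rec[of "{c}"] j by blast
    obtain b where b: "b \<in> D" "listset (W[j := W ! j - {c}]) \<subseteq> fiber S {b}"
      using rec[of "W ! j - {c}"] j by blast
    have "w \<in> listset (W[j := {c}]) \<or> w \<in> listset (W[j := W ! j - {c}])" if "w \<in> listset W" for w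
      using that j by (auto simp: mem_listset nth_list_update)
    then have *: "a # w \<in> S \<or> b # w \<in> S" if "w \<in> listset W" for w
      using that a b unfolding fiber_def by blast
    show ?thesis
    proof (cases "a = b")
      case True
      then show ?thesis using * a unfolding fiber_def by blast
    next
      case False
      then show ?thesis using two_fibers[OF assms(1) False *] a b by blast
    qed
  next
    case False
    obtain w where w: "w \<in> listset W"
    proof
      show "map (\<lambda>X. SOME x. x \<in> X) W \<in> listset W"
        using less.prems(1) by (auto simp: mem_listset some_in_eq)
    qed
    have "u = w" if "u \<in> listset W" for u
    proof (rule nth_equalityI)
      show "length u = length w" using that w by (simp add: mem_listset)
      fix i assume "i < length u"
      then have "i < length W" "u ! i \<in> W ! i" "w ! i \<in> W ! i" using that w by (auto simp: mem_listset)
      then show "u ! i = w ! i" using False by (metis singletonD)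
    qed
    then show ?thesis using less.prems(2)[OF w] unfolding fiber_def by blast
  qed
qed

section \<open>Inheritance of galleries by projections and fibers\<close>

definition projection :: "'a list set \<Rightarrow> 'a set \<Rightarrow> 'a list set" where
  "projection S D = {x. \<exists>a\<in>D. a # x \<in> S}"

lemma small_box_finite: "small_box A \<Longrightarrow> X \<in> set A \<Longrightarrow> finite X \<and> X \<noteq> {}"
  unfolding small_box_def by fastforce

text \<open>A box over a pair of values is itself a cube: since \<open>{a, b} # A\<close> and
  \<open>{a, b} # B\<close> share their first side, the gallery step happens in the tail. With
  \<open>a = b\<close> this covers single fibers.\<close>

lemma fiber_step:
  assumes "galleries S" "small_box A" "parallel A B" "listset A \<subseteq> fiber S {a, b}" "listset B \<subseteq> fiber S {a, b}" "A \<noteq> B"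
  shows "\<exists>i<length A. A ! i \<noteq> B ! i \<and> listset (A[i := B ! i]) \<subseteq> fiber S {a, b}"
proof -
  have "small_box ({a, b} # A)" "parallel ({a, b} # A) ({a, b} # B)" using assms by auto
  then obtain i where i: "i < length ({a, b} # A)" "({a, b} # A) ! i \<noteq> ({a, b} # B) ! i"
      "listset (({a, b} # A)[i := ({a, b} # B) ! i]) \<subseteq> S"
    using galleriesD[OF assms(1), of "{a, b} # A" "{a, b} # B"] assms by (auto simp only: listset_Cons_subset)
  obtain j where "i = Suc j" using i(2) by (cases i) auto
  then show ?thesis using i by (auto simp only: listset_Cons_subset nth_Cons_Suc list_update_code length_Cons Suc_less_eq)
qed

text \<open>By \<open>fiber_cover\<close> each of the two cubes lifts to a single fiber, and the
  lifts are parallel cubes of \<open>S\<close>. A gallery step between the lifts descends to the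
  projection if it leaves the value in front alone.\<close>

lemma galleries_projection:
  assumes "galleries S" shows "galleries (projection S D)"
  unfolding galleries_def
proof (intro allI impI)
  fix A B assume AB: "small_box A" "parallel A B" "listset A \<subseteq> projection S D" "listset B \<subseteq> projection S D" "A \<noteq> B"
  obtain a where a: "a \<in> D" "listset A \<subseteq> fiber S {a}"
    using fiber_cover[OF assms, of A D] small_box_finite AB unfolding projection_def by blast
  obtain b where b: "b \<in> D" "listset B \<subseteq> fiber S {b}"
    using fiber_cover[OF assms, of B D] small_box_finite[OF small_box_par] AB unfolding projection_def by blast
  have sub: "fiber S {c} \<subseteq> projection S D" if "c \<in> D" for c
    using that unfolding fiber_def projection_def by blast
  have "\<exists>c\<in>D. \<exists>i<length A. A ! i \<noteq> B ! i \<and> listset (A[i := B ! i]) \<subseteq> fiber S {c}"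
  \<comment> \<open>If \<open>A\<close> lies in the fiber over \<open>b\<close> too, both cubes lift
    to that fiber. Otherwise the step cannot replace \<open>a\<close> by \<open>b\<close>, so it
    happens in the tail.\<close>
  proof (cases "listset A \<subseteq> fiber S {b}")
    case True
    then have "\<exists>i<length A. A ! i \<noteq> B ! i \<and> listset (A[i := B ! i]) \<subseteq> fiber S {b}"
      using fiber_step[OF assms AB(1,2), of b b] AB b by simp
    then show ?thesis using b(1) by blast
  next
    case False
    then have ab: "a \<noteq> b" using a by blast
    have "small_box ({a} # A)" "parallel ({a} # A) ({b} # B)" using AB pair_singleton by auto
    then obtain i where i: "i < length ({a} # A)" "({a} # A) ! i \<noteq> ({b} # B) ! i"
      "listset (({a} # A)[i := ({b} # B) ! i]) \<subseteq> S"
      using galleriesD[OF assms(1), of "{a} # A" "{b} # B"] a b ab by (auto simp only: listset_Cons_subset)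
    obtain j where "i = Suc j"
      using i(3) False by (cases i) (auto simp only: listset_Cons_subset nth_Cons_0 list_update_code)
    then have "j < length A" "A ! j \<noteq> B ! j" "listset (A[j := B ! j]) \<subseteq> fiber S {a}"
      using i by (auto simp only: listset_Cons_subset nth_Cons_Suc list_update_code length_Cons Suc_less_eq)
    then show ?thesis using a(1) by blast
  qed
  then show "\<exists>i<length A. A ! i \<noteq> B ! i \<and> listset (A[i := B ! i]) \<subseteq> projection S D" using sub by blast
qed

lemma fiber_Union: "listset C \<subseteq> fiber S X \<longleftrightarrow> (\<forall>a\<in>X. listset C \<subseteq> fiber S {a})"
  unfolding fiber_def by blast

text \<open>For three or more elements, the first and last steps of galleries over three proper subsets of
  \<open>X\<close> are compared; they cannot all fit together, and a mismatch yields a region that every fiber meets,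
  so that the Helly property applies.\<close>

lemma galleries_fiber:
  assumes "galleries S" "finite X" "X \<noteq> {}" shows "galleries (fiber S X)"
  using assms(2,3)
proof (induction X rule: finite_psubset_induct)
  case (psubset X)
  show ?case
  proof (cases "\<exists>a b. X = {a, b}")
    case True
    then show ?thesis using fiber_step[OF assms(1)] unfolding galleries_def by blast
  next
    case False
    then obtain a b c where abc: "a \<in> X" "b \<in> X" "c \<in> X" "a \<noteq> b" "a \<noteq> c" "b \<noteq> c"
      using obtain_three[of X] psubset.prems(1) by (metis (no_types))
    have IH: "galleries (fiber S (X - {d}))" if "d \<in> X" for d
      using psubset.IH[of "X - {d}"] that abc by blast
    show ?thesis
      unfolding galleries_def
    proof (intro allI impI)
      fix A B assume "small_box A" "parallel A B" "listset A \<subseteq> fiber S X" "listset B \<subseteq> fiber S X" "A \<noteq> B"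
      then show "\<exists>i<length A. A ! i \<noteq> B ! i \<and> listset (A[i := B ! i]) \<subseteq> fiber S X"
      proof (induction "hdist A B" arbitrary: B rule: less_induct)
        case (less B)
        have len: "length B = length A" using less.prems by (simp add: parallel_def)
        show ?case
        proof (cases "\<exists>i<length A. A ! i \<noteq> B ! i \<and> A[i := B ! i] = B")
          case True
          then show ?thesis using less.prems by metis
        next
          case noend: False
          \<comment> \<open>For each \<open>d\<close> the fiber over \<open>X - {d}\<close> has
            galleries, and \<open>noend\<close> guarantees that a first step from \<open>A\<close>
            does not arrive at \<open>B\<close>. So there is also a last step into \<open>B\<close>,
            in a coordinate that the first step has not changed.\<close>
          have steps: "\<exists>i k. i < length A \<and> k < length A \<and> i \<noteq> k \<and> A ! i \<noteq> B ! i \<and> A ! k \<noteq> B ! k \<and>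
              listset (A[i := B ! i]) \<subseteq> fiber S (X - {d}) \<and> listset (B[k := A ! k]) \<subseteq> fiber S (X - {d})"
            if d: "d \<in> X" for d
          proof -
            have sub: "fiber S X \<subseteq> fiber S (X - {d})" unfolding fiber_def by blast
            obtain i where i: "i < length A" "A ! i \<noteq> B ! i" "listset (A[i := B ! i]) \<subseteq> fiber S (X - {d})"
              using galleriesD[OF IH[OF d], of A B] less.prems sub by blast
            let ?U = "A[i := B ! i]"
            have U: "?U \<noteq> B" using noend i by blast
            have "parallel B ?U" using parallel_btw[OF less.prems(2) between_update[OF len]] parallel_sym by blast
            then obtain k where k: "k < length B" "B ! k \<noteq> ?U ! k" "listset (B[k := ?U ! k]) \<subseteq> fiber S (X - {d})"
              using galleriesD[OF IH[OF d], of B ?U] small_box_par less.prems i sub U by (metis subset_trans)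
            then have ki: "k \<noteq> i" using i by auto
            then have "A ! k \<noteq> B ! k" "listset (B[k := A ! k]) \<subseteq> fiber S (X - {d})" "k < length A"
              using k len by auto
            then show ?thesis using i(1-3) ki by blast
          qed
          obtain f g where fg: "\<And>d. d \<in> X \<Longrightarrow> f d < length A \<and> g d < length A \<and> f d \<noteq> g d \<and>
              A ! f d \<noteq> B ! f d \<and> A ! g d \<noteq> B ! g d \<and>
              listset (A[f d := B ! f d]) \<subseteq> fiber S (X - {d}) \<and> listset (B[g d := A ! g d]) \<subseteq> fiber S (X - {d})"
            using steps by metis
          \<comment> \<open>If \<open>f d = g e\<close> held for all distinct \<open>d\<close> and
            \<open>e\<close>, then \<open>f a = g b = f c = g a\<close>, contrary to
            \<open>f a \<noteq> g a\<close>. This is where three elements are used.\<close>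
          obtain d e where de: "d \<in> X" "e \<in> X" "d \<noteq> e" "f d \<noteq> g e"
            using fg abc by metis
          \<comment> \<open>The two prescribed sides keep cubes of \<open>R\<close> off both ends:
            the side at \<open>f d\<close> excludes \<open>A\<close>, the side at \<open>g e\<close>
            excludes \<open>B\<close>. The fiber over \<open>d\<close> meets \<open>R\<close> in the
            cube before the last step belonging to \<open>e\<close>, every other fiber meets it in
            the cube after the first step belonging to \<open>d\<close>.\<close>
          define R where "R = {C. between A C B \<and> C ! f d = B ! f d \<and> C ! g e = A ! g e}"
          define F where "F h = {C. listset C \<subseteq> fiber S {h} \<and> parallel A C \<and> between A C B}" for h
          have "\<exists>C\<in>R. \<forall>h\<in>X. C \<in> F h"
          proof (rule helly)
            show "finite X" "X \<noteq> {}" using psubset by auto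
            fix h k C D assume hk: "C \<in> F h" "D \<in> F k"
            then have "parallel A C" "between A C B" "between A D B" "parallel A D" unfolding F_def by auto
            then have CD: "parallel C D" "small_box C"
              using parallel_between less.prems(1,2) small_box_par by blast+
            show "\<exists>z. between C z D \<and> z \<in> F h \<and> z \<in> F k"
              using switch[OF assms(1) CD(2,1), of h k] hk parallel_convex[of A C D] between_convex[of A C B D]
              unfolding F_def by blast
          next
            fix C D E assume "C \<in> R" "D \<in> R" "between C E D"
            moreover from this have "between A E B" using between_convex[of A C B D E] unfolding R_def by blast
            moreover have "f d < length A" "g e < length A" using fg de by auto
            ultimately show "E \<in> R" unfolding R_def between_def by auto
          next
            fix h assume h: "h \<in> X"
            show "\<exists>C. C \<in> F h \<and> C \<in> R"
            proof (cases "h = d")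
              case True
              let ?C = "B[g e := A ! g e]"
              have "between A ?C B" using between_update[of A B "g e"] between_sym len by metis
              moreover have "listset ?C \<subseteq> fiber S {h}"
                using fg[OF de(2)] True de(3) h fiber_Union[of ?C S "X - {e}"] by blast
              moreover have "?C ! f d = B ! f d" "?C ! g e = A ! g e"
                using fg[OF de(1)] fg[OF de(2)] de(4) len by auto
              ultimately show ?thesis using parallel_btw[OF less.prems(2)] unfolding F_def R_def by blast
            next
              case False
              let ?C = "A[f d := B ! f d]"
              have "between A ?C B" using between_update len by metis
              moreover have "listset ?C \<subseteq> fiber S {h}"
                using fg[OF de(1)] False h fiber_Union[of ?C S "X - {d}"] by blast
              moreover have "?C ! f d = B ! f d" "?C ! g e = A ! g e"
                using fg[OF de(1)] fg[OF de(2)] de(4) by auto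
              ultimately show ?thesis using parallel_btw[OF less.prems(2)] unfolding F_def R_def by blast
            qed
          qed
          \<comment> \<open>\<open>C\<close> is a cube of all fibers strictly between the ends; the
            step from \<open>A\<close> towards \<open>C\<close>, which the inner induction provides,
            is a step towards \<open>B\<close>.\<close>
          then obtain C where C: "C \<in> R" "\<And>h. h \<in> X \<Longrightarrow> C \<in> F h" by blast
          have "listset C \<subseteq> fiber S X" using C(2) fiber_Union unfolding F_def by blast
          moreover have "A \<noteq> C" using C(1) fg[OF de(1)] unfolding R_def by auto
          moreover have "hdist A C < hdist A B"
            using hdist_less[of A C B] C(1) fg[OF de(2)] unfolding R_def by auto
          moreover have "parallel A C" using C(2) abc unfolding F_def by blast
          ultimately obtain i where i: "i < length A" "A ! i \<noteq> C ! i" "listset (A[i := C ! i]) \<subseteq> fiber S X"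
            using less.hyps[of C] less.prems by blast
          have "between A C B" using C(1) unfolding R_def by blast
          then have "C ! i = B ! i" using i(1,2) unfolding between_def by force
          then have "A ! i \<noteq> B ! i" "listset (A[i := B ! i]) \<subseteq> fiber S X" using i by auto
          then show ?thesis using i(1) by blast
        qed
      qed
    qed
  qed
qed

section \<open>Galleries characterize ampleness\<close>

text \<open>The case of \<open>switch\<close> for zero-dimensional cubes, with boxes of singletons
  standing for points. It supplies the pairwise hypothesis of \<open>helly\<close>.\<close>

lemma switch_point:
  assumes "galleries S" "a # x \<in> S" "b # y \<in> S" "length y = length x"
  shows "\<exists>z. between x z y \<and> a # z \<in> S \<and> b # z \<in> S"
proof -
  let ?s = "map (\<lambda>u. {u :: 'a})"
  have ls: "listset (?s z) = {z}" for z by (rule listset_singletons)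
  have "\<exists>C. between (?s x) C (?s y) \<and> listset C \<subseteq> fiber S {a} \<and> listset C \<subseteq> fiber S {b}"
  proof (rule switch[OF assms(1)])
    show "small_box (?s x)" unfolding small_box_def by auto
    show "parallel (?s x) (?s y)" using assms(4) by (auto simp: parallel_def)
  qed (use assms ls in \<open>auto simp: fiber_def\<close>)
  then obtain C where C: "between (?s x) C (?s y)" "listset C \<subseteq> fiber S {a}" "listset C \<subseteq> fiber S {b}" by blast
  define z where "z = map the_elem C"
  have len: "length C = length x" using C(1) unfolding between_def by auto
  have Ci: "C ! i = {x ! i} \<or> C ! i = {y ! i}" if "i < length x" for i
    using C(1) that assms(4) unfolding between_def by auto
  have "C = ?s z"
  proof (rule nth_equalityI)
    fix i assume "i < length C"
    then obtain c where "C ! i = {c}" using Ci[of i] len by force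
    then show "C ! i = ?s z ! i" using \<open>i < length C\<close> by (simp add: z_def)
  qed (simp add: z_def)
  then have "z \<in> fiber S {a}" "z \<in> fiber S {b}" using C ls[of z] by auto
  moreover have "between x z y" unfolding between_def
  proof (intro conjI allI impI)
    fix i assume "i < length x"
    then have "z ! i = the_elem (C ! i)" "C ! i = {x ! i} \<or> C ! i = {y ! i}" using Ci len by (simp_all add: z_def)
    then show "z ! i = x ! i \<or> z ! i = y ! i" by (elim disjE) simp_all
  qed (use assms len z_def in auto)
  ultimately show ?thesis unfolding fiber_def by blast
qed

lemma transversal_finite:
  assumes "transversal \<alpha> W" "finite \<alpha>" "\<alpha> \<noteq> {}"
  shows "finite W \<and> W \<noteq> {}"
proof -
  have "finite (W \<inter> B)" if "B \<in> \<alpha>" for B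
  proof -
    have "\<exists>!x. x \<in> W \<inter> B" using assms(1) that unfolding transversal_def by simp
    then obtain x where "W \<inter> B = {x}" by auto
    then show ?thesis by simp
  qed
  then have "finite (\<Union>B\<in>\<alpha>. W \<inter> B)" using assms(2) by (intro finite_UN_I)
  moreover have "W \<subseteq> (\<Union>B\<in>\<alpha>. W \<inter> B)" using assms(1) unfolding transversal_def by blast
  ultimately have "finite W" by (rule rev_finite_subset)
  moreover have "W \<noteq> {}" using assms(1,3) unfolding transversal_def by blast
  ultimately show ?thesis by blast
qed

lemma transversal_meets:
  assumes "list_all2 transversal \<Lambda> Ws" "Q \<in> listset \<Lambda>"
  shows "\<exists>x\<in>listset Ws. x \<in> listset Q"
proof -
  have len: "length Ws = length \<Lambda>" "length Q = length \<Lambda>"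
    using assms by (auto simp: mem_listset list_all2_lengthD)
  have "\<forall>i. \<exists>x. i < length \<Lambda> \<longrightarrow> x \<in> Ws ! i \<and> x \<in> Q ! i"
  proof
    fix i
    show "\<exists>x. i < length \<Lambda> \<longrightarrow> x \<in> Ws ! i \<and> x \<in> Q ! i"
    proof (cases "i < length \<Lambda>")
      case True
      then have "transversal (\<Lambda> ! i) (Ws ! i)" "Q ! i \<in> \<Lambda> ! i"
        using assms by (auto simp: mem_listset list_all2_nthD)
      then show ?thesis unfolding transversal_def by blast
    qed auto
  qed
  then obtain f where "\<And>i. i < length \<Lambda> \<Longrightarrow> f i \<in> Ws ! i \<and> f i \<in> Q ! i" by metis
  then have "map f [0..<length \<Lambda>] \<in> listset Ws" "map f [0..<length \<Lambda>] \<in> listset Q"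
    using len by (auto simp: mem_listset)
  then show ?thesis by blast
qed

lemma strongly_shattered_iff:
  "strongly_shattered S \<Lambda> \<longleftrightarrow> (\<exists>Ws. list_all2 transversal \<Lambda> Ws \<and> listset Ws \<subseteq> S)"
  unfolding strongly_shattered_def copies_def by blast

lemma galleries_strongly_shattered:
  assumes "galleries S" "\<And>\<alpha>. \<alpha> \<in> set \<Lambda> \<Longrightarrow> finite \<alpha> \<and> \<alpha> \<noteq> {} \<and> disjoint \<alpha>" "shattered S \<Lambda>"
  shows "strongly_shattered S \<Lambda>"
  using assms
proof (induction \<Lambda> arbitrary: S)
  case Nil
  then have "[] \<in> S" unfolding shattered_def minor_subproduct_def by auto
  then show ?case unfolding strongly_shattered_iff by auto
next
  case (Cons \<alpha> \<Lambda>)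
  have fin: "finite \<alpha>" "\<alpha> \<noteq> {}" "disjoint \<alpha>" using Cons.prems(2)[of \<alpha>] by auto
  have fiber: "\<exists>a\<in>D. \<exists>Ws. list_all2 transversal \<Lambda> Ws \<and> listset Ws \<subseteq> fiber S {a}" if D: "D \<in> \<alpha>" for D
  proof -
    have "shattered (projection S D) \<Lambda>"
      unfolding shattered_def minor_subproduct_def
    proof
      fix Q assume "Q \<in> listset \<Lambda>"
      then have "D # Q \<in> listset (\<alpha> # \<Lambda>)" using D by (auto simp: set_Cons_def)
      then obtain x where "x \<in> S" "x \<in> listset (D # Q)"
        using Cons.prems(3) unfolding shattered_def minor_subproduct_def by blast
      then show "projection S D \<inter> listset Q \<noteq> {}" by (auto simp: set_Cons_def projection_def)
    qed
    then have "strongly_shattered (projection S D) \<Lambda>"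
      by (rule Cons.IH[OF galleries_projection[OF Cons.prems(1)], rotated]) (use Cons.prems(2) in simp)
    then obtain Ws where Ws: "list_all2 transversal \<Lambda> Ws" "listset Ws \<subseteq> projection S D"
      unfolding strongly_shattered_iff by blast
    have "finite W \<and> W \<noteq> {}" if W: "W \<in> set Ws" for W
    proof -
      obtain i where i: "i < length Ws" "W = Ws ! i" using W by (metis in_set_conv_nth)
      then have "\<Lambda> ! i \<in> set \<Lambda>" "transversal (\<Lambda> ! i) W"
        using Ws(1) by (auto simp: list_all2_lengthD list_all2_nthD2)
      then show ?thesis using transversal_finite[of "\<Lambda> ! i" W] Cons.prems(2)[of "\<Lambda> ! i"] by simp
    qed
    then have "\<exists>a\<in>D. listset Ws \<subseteq> fiber S {a}"
      by (rule fiber_cover[OF Cons.prems(1)]) (use Ws(2) in \<open>auto simp: projection_def\<close>)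
    then show ?thesis using Ws by blast
  qed
  then obtain f where f: "\<And>D. D \<in> \<alpha> \<Longrightarrow> f D \<in> D"
      "\<And>D. D \<in> \<alpha> \<Longrightarrow> \<exists>Ws. list_all2 transversal \<Lambda> Ws \<and> listset Ws \<subseteq> fiber S {f D}" by metis
  have X: "finite (f ` \<alpha>)" "f ` \<alpha> \<noteq> {}" using fin by auto
  have "shattered (fiber S (f ` \<alpha>)) \<Lambda>"
    unfolding shattered_def minor_subproduct_def
  proof
    fix Q assume Q: "Q \<in> listset \<Lambda>"
    \<comment> \<open>\<open>S\<close> may contain lists of several lengths, while
      \<open>switch_point\<close> compares points of equal length; hence the length condition in
      these sets.\<close>
    have "\<exists>x\<in>listset Q. \<forall>a\<in>f ` \<alpha>. x \<in> {x. a # x \<in> S \<and> length x = length \<Lambda>}"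
    proof (rule helly[OF X])
      show "\<exists>z. between x z y \<and> z \<in> {x. a # x \<in> S \<and> length x = length \<Lambda>} \<and> z \<in> {x. b # x \<in> S \<and> length x = length \<Lambda>}"
        if "x \<in> {x. a # x \<in> S \<and> length x = length \<Lambda>}" "y \<in> {x. b # x \<in> S \<and> length x = length \<Lambda>}" for a b x y
        using switch_point[OF Cons.prems(1), of a x b y] that unfolding between_def by auto
      show "z \<in> listset Q" if "x \<in> listset Q" "y \<in> listset Q" "between x z y" for x y z
        using that unfolding between_def mem_listset by metis
      show "\<exists>x. x \<in> {x. a # x \<in> S \<and> length x = length \<Lambda>} \<and> x \<in> listset Q" if a: "a \<in> f ` \<alpha>" for a
      proof -
        obtain Ws where Ws: "list_all2 transversal \<Lambda> Ws" "listset Ws \<subseteq> fiber S {a}" using a f(2) by blast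
        then obtain x where "x \<in> listset Ws" "x \<in> listset Q" using transversal_meets Q by blast
        moreover from this have "a # x \<in> S" using Ws(2) unfolding fiber_def by blast
        moreover have "length x = length \<Lambda>" using \<open>x \<in> listset Q\<close> Q by (simp add: mem_listset)
        ultimately have "a # x \<in> S" "length x = length \<Lambda>" "x \<in> listset Q" by blast+
        then show ?thesis by blast
      qed
    qed
    then show "fiber S (f ` \<alpha>) \<inter> listset Q \<noteq> {}" unfolding fiber_def by blast
  qed
  then have "strongly_shattered (fiber S (f ` \<alpha>)) \<Lambda>"
    by (rule Cons.IH[OF galleries_fiber[OF Cons.prems(1) X], rotated]) (use Cons.prems(2) in simp)
  then obtain Ws where Ws: "list_all2 transversal \<Lambda> Ws" "listset Ws \<subseteq> fiber S (f ` \<alpha>)"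
    unfolding strongly_shattered_iff by blast
  have "transversal \<alpha> (f ` \<alpha>)" unfolding transversal_def
  proof (intro conjI ballI)
    show "f ` \<alpha> \<subseteq> \<Union>\<alpha>" using f(1) by blast
    fix B assume B: "B \<in> \<alpha>"
    have "y = f B" if y: "y \<in> f ` \<alpha> \<inter> B" for y
    proof -
      obtain D where D: "D \<in> \<alpha>" "y = f D" using y by blast
      then have "D = B" using f(1)[OF D(1)] y B fin(3) disjointD[of \<alpha> D B] by blast
      then show ?thesis using D by simp
    qed
    moreover have "f B \<in> f ` \<alpha> \<inter> B" using f(1)[OF B] B by simp
    ultimately show "\<exists>!x. x \<in> f ` \<alpha> \<inter> B" by (rule ex1I[rotated])
  qed
  then have "list_all2 transversal (\<alpha> # \<Lambda>) (f ` \<alpha> # Ws)" using Ws by simp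
  moreover have "listset (f ` \<alpha> # Ws) \<subseteq> S" using Ws(2) by (simp only: listset_Cons_subset)
  ultimately show ?case unfolding strongly_shattered_iff by blast
qed

lemma galleries_imp_ample:
  assumes "galleries S" "\<And>U. U \<in> set Us \<Longrightarrow> finite U \<and> U \<noteq> {}"
  shows "ample Us S"
  unfolding ample_def
proof (intro allI impI)
  fix \<Lambda> assume gp: "generalized_partition Us \<Lambda>" and sh: "shattered S \<Lambda>"
  show "strongly_shattered S \<Lambda>"
  proof (rule galleries_strongly_shattered[OF assms(1) _ sh])
    fix \<alpha> assume "\<alpha> \<in> set \<Lambda>"
    then obtain U where "U \<in> set Us" "partition_on U \<alpha>"
      using gp unfolding generalized_partition_def by (metis list_all2_conv_all_nth in_set_conv_nth)
    then show "finite \<alpha> \<and> \<alpha> \<noteq> {} \<and> disjoint \<alpha>"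
      using assms(2)[of U] finite_elements[of U \<alpha>] partition_onD1[of U \<alpha>] partition_onD2[of U \<alpha>] by auto
  qed
qed

section \<open>From ampleness to galleries\<close>

lemma transversalD: "transversal \<alpha> W \<Longrightarrow> B \<in> \<alpha> \<Longrightarrow> \<exists>!x. x \<in> W \<inter> B"
  unfolding transversal_def by (drule conjunct2) (erule bspec)

lemma transversal_restrict:
  assumes "\<And>B. B \<in> \<alpha> \<Longrightarrow> \<exists>!x. x \<in> W \<inter> B"
  shows "transversal \<alpha> (W \<inter> \<Union>\<alpha>)"
  unfolding transversal_def
proof (intro conjI ballI)
  fix B assume B: "B \<in> \<alpha>"
  then have "W \<inter> \<Union>\<alpha> \<inter> B = W \<inter> B" by blast
  then show "\<exists>!x. x \<in> W \<inter> \<Union>\<alpha> \<inter> B" using assms[OF B] by simp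
qed blast

lemma psubset_if_subset_Diff: "X \<subseteq> Y - {j} \<Longrightarrow> j \<in> Y \<Longrightarrow> X \<subset> Y"
  by blast

text \<open>Partitions of subsets of the factors are covered too: the uncovered part of a factor becomes a
  further block if the result is still shattered, and otherwise is absorbed by an existing block.\<close>

lemma ample_partial:
  assumes "ample Us S"
    and "list_all2 (\<lambda>U \<alpha>. \<Union>\<alpha> \<subseteq> U \<and> disjoint \<alpha> \<and> {} \<notin> \<alpha> \<and> \<alpha> \<noteq> {}) Us \<Lambda>" "shattered S \<Lambda>"
  shows "strongly_shattered S \<Lambda>"
  using assms(2,3)
proof (induction "card {i. i < length Us \<and> \<Union>(\<Lambda> ! i) \<noteq> Us ! i}" arbitrary: \<Lambda> rule: less_induct)
  case less
  have len: "length \<Lambda> = length Us" using less.prems(1) by (simp add: list_all2_lengthD)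
  have prem: "\<Union>(\<Lambda> ! i) \<subseteq> Us ! i" "disjoint (\<Lambda> ! i)" "{} \<notin> \<Lambda> ! i" "\<Lambda> ! i \<noteq> {}" if "i < length Us" for i
    using list_all2_nthD[OF less.prems(1) that] by auto
  show ?case
  proof (cases "\<exists>j<length Us. \<Union>(\<Lambda> ! j) \<noteq> Us ! j")
    case False
    then have "generalized_partition Us \<Lambda>"
      unfolding generalized_partition_def list_all2_conv_all_nth partition_on_def using len prem by auto
    then show ?thesis using assms(1) less.prems(2) unfolding ample_def by blast
  next
    case True
    then obtain j where j: "j < length Us" "\<Union>(\<Lambda> ! j) \<noteq> Us ! j" by blast
    define V where "V = \<Union>(\<Lambda> ! j)"
    define N where "N = Us ! j - V"
    have N: "N \<noteq> {}" "N \<inter> V = {}" "N \<union> V = Us ! j" using j prem(1)[OF j(1)] unfolding N_def V_def by auto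
    have rec: "strongly_shattered S (\<Lambda>[j := \<beta>])"
      if "\<Union>\<beta> = Us ! j" "disjoint \<beta>" "{} \<notin> \<beta>" "\<beta> \<noteq> {}" "shattered S (\<Lambda>[j := \<beta>])" for \<beta>
    proof (rule less.hyps)
      have "{i. i < length Us \<and> \<Union>(\<Lambda>[j := \<beta>] ! i) \<noteq> Us ! i} \<subseteq> {i. i < length Us \<and> \<Union>(\<Lambda> ! i) \<noteq> Us ! i} - {j}"
      proof
        fix i assume i: "i \<in> {i. i < length Us \<and> \<Union>(\<Lambda>[j := \<beta>] ! i) \<noteq> Us ! i}"
        then have "i \<noteq> j" using that(1) len by auto
        then show "i \<in> {i. i < length Us \<and> \<Union>(\<Lambda> ! i) \<noteq> Us ! i} - {j}" using i by simp
      qed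
      then have "{i. i < length Us \<and> \<Union>(\<Lambda>[j := \<beta>] ! i) \<noteq> Us ! i} \<subset> {i. i < length Us \<and> \<Union>(\<Lambda> ! i) \<noteq> Us ! i}"
        by (rule psubset_if_subset_Diff) (use j in simp)
      then show "card {i. i < length Us \<and> \<Union>(\<Lambda>[j := \<beta>] ! i) \<noteq> Us ! i} < card {i. i < length Us \<and> \<Union>(\<Lambda> ! i) \<noteq> Us ! i}"
        by (intro psubset_card_mono) auto
      show "list_all2 (\<lambda>U \<alpha>. \<Union>\<alpha> \<subseteq> U \<and> disjoint \<alpha> \<and> {} \<notin> \<alpha> \<and> \<alpha> \<noteq> {}) Us (\<Lambda>[j := \<beta>])"
        unfolding list_all2_conv_all_nth
      proof (intro conjI allI impI)
        fix i assume "i < length Us"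
        then show "\<Union>(\<Lambda>[j := \<beta>] ! i) \<subseteq> Us ! i" "disjoint (\<Lambda>[j := \<beta>] ! i)" "{} \<notin> \<Lambda>[j := \<beta>] ! i" "\<Lambda>[j := \<beta>] ! i \<noteq> {}"
          using prem[of i] that j len by (cases "i = j"; simp)+
      qed (simp add: len)
    qed (fact that(5))
    have fin: "strongly_shattered S \<Lambda>"
      if "list_all2 transversal (\<Lambda>[j := \<beta>]) Ws" "listset Ws \<subseteq> S" "transversal (\<Lambda> ! j) (Ws ! j \<inter> V)" for \<beta> Ws
      unfolding strongly_shattered_iff
    proof (intro exI conjI)
      have lW: "length Ws = length Us" using list_all2_lengthD[OF that(1)] len by simp
      show "list_all2 transversal \<Lambda> (Ws[j := Ws ! j \<inter> V])"
        unfolding list_all2_conv_all_nth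
      proof (intro conjI allI impI)
        fix i assume i: "i < length \<Lambda>"
        show "transversal (\<Lambda> ! i) (Ws[j := Ws ! j \<inter> V] ! i)"
          using that(3) list_all2_nthD[OF that(1), of i] i lW len by (cases "i = j") auto
      qed (simp add: len lW)
      show "listset (Ws[j := Ws ! j \<inter> V]) \<subseteq> S"
        using listset_update_subset[of j Ws "Ws ! j \<inter> V"] j lW that(2) by auto
    qed
    show ?thesis
    proof (cases "shattered S (\<Lambda>[j := insert N (\<Lambda> ! j)])")
      case True
      have "strongly_shattered S (\<Lambda>[j := insert N (\<Lambda> ! j)])"
        by (rule rec) (use True prem[OF j(1)] N V_def in \<open>auto simp: pairwise_insert disjnt_def\<close>)
      then obtain Ws where Ws: "list_all2 transversal (\<Lambda>[j := insert N (\<Lambda> ! j)]) Ws" "listset Ws \<subseteq> S"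
        unfolding strongly_shattered_iff by blast
      have "transversal (insert N (\<Lambda> ! j)) (Ws ! j)"
        using list_all2_nthD[OF Ws(1), of j] j len by simp
      then have "transversal (\<Lambda> ! j) (Ws ! j \<inter> V)"
        unfolding V_def by (intro transversal_restrict) (simp add: transversal_def)
      then show ?thesis using fin Ws by blast
    next
      case False
      then obtain Q where Q: "Q \<in> listset (\<Lambda>[j := insert N (\<Lambda> ! j)])" "S \<inter> listset Q = {}"
        unfolding shattered_def minor_subproduct_def by blast
      \<comment> \<open>The box \<open>Q\<close> missed by \<open>S\<close> must use the new block
        \<open>N\<close>. Merging \<open>N\<close> into any block \<open>D\<close> keeps the system
        shattered, because every new box contains a box of \<open>\<Lambda>\<close>.\<close>
      obtain D where D: "D \<in> \<Lambda> ! j" using prem(4)[OF j(1)] by blast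
      let ?\<beta> = "insert (D \<union> N) (\<Lambda> ! j - {D})"
      have dj: "B \<inter> C = {}" if "B \<in> \<Lambda> ! j" "C \<in> \<Lambda> ! j" "B \<noteq> C" for B C
        using that prem(2)[OF j(1)] disjointD by blast
      have QN: "Q ! j = N"
      proof (rule ccontr)
        assume "Q ! j \<noteq> N"
        moreover have "Q ! i \<in> \<Lambda>[j := insert N (\<Lambda> ! j)] ! i" if "i < length \<Lambda>" for i
          using Q(1) that unfolding mem_listset by simp
        ultimately have "Q ! i \<in> \<Lambda> ! i" if "i < length \<Lambda>" for i
          using that by (cases "i = j") (force simp: nth_list_update)+
        then have "Q \<in> listset \<Lambda>" using Q(1) unfolding mem_listset by auto
        then show False using less.prems(2) Q(2) unfolding shattered_def minor_subproduct_def by blast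
      qed
      have "strongly_shattered S (\<Lambda>[j := ?\<beta>])"
      proof (rule rec)
        have "\<Union>?\<beta> = N \<union> \<Union>(\<Lambda> ! j)" using D by auto
        then show "\<Union>?\<beta> = Us ! j" using N(3) unfolding V_def by simp
        show "{} \<notin> ?\<beta>" using N(1) prem(3)[OF j(1)] by simp
        show "?\<beta> \<noteq> {}" by simp
        have "disjnt (D \<union> N) B" if "B \<in> \<Lambda> ! j - {D}" for B
          using that dj[OF D, of B] N(2) unfolding V_def disjnt_def by blast
        moreover have "disjoint (\<Lambda> ! j - {D})" using prem(2)[OF j(1)] by (simp add: pairwise_def)
        ultimately show "disjoint ?\<beta>" unfolding pairwise_insert using disjnt_sym by blast
        show "shattered S (\<Lambda>[j := ?\<beta>])" unfolding shattered_def minor_subproduct_def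
        proof
          fix R assume R: "R \<in> listset (\<Lambda>[j := ?\<beta>])"
          have lR: "length R = length \<Lambda>" using R by (simp add: mem_listset)
          have Ri: "R ! i \<in> \<Lambda>[j := ?\<beta>] ! i" if "i < length \<Lambda>" for i
            using R that unfolding mem_listset by simp
          define B where "B = (if R ! j = D \<union> N then D else R ! j)"
          have "B \<in> \<Lambda> ! j" "B \<subseteq> R ! j" using Ri[of j] j len D unfolding B_def by auto
          have "R[j := B] ! i \<in> \<Lambda> ! i" if "i < length \<Lambda>" for i
            using Ri[OF that] \<open>B \<in> \<Lambda> ! j\<close> that lR by (cases "i = j") auto
          then have "R[j := B] \<in> listset \<Lambda>" using lR unfolding mem_listset by simp
          then have "S \<inter> listset (R[j := B]) \<noteq> {}"
            using less.prems(2) unfolding shattered_def minor_subproduct_def by blast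
          then show "S \<inter> listset R \<noteq> {}"
            using listset_update_subset[of j R B] \<open>B \<subseteq> R ! j\<close> lR j len by auto
        qed
      qed
      then obtain Ws where Ws: "list_all2 transversal (\<Lambda>[j := ?\<beta>]) Ws" "listset Ws \<subseteq> S"
        unfolding strongly_shattered_iff by blast
      have lW: "length Ws = length Us" using list_all2_lengthD[OF Ws(1)] len by simp
      have tj: "transversal ?\<beta> (Ws ! j)" using list_all2_nthD[OF Ws(1), of j] j len by simp
      have one: "\<exists>!x. x \<in> Ws ! j \<inter> B" if "B \<in> ?\<beta>" for B
        using transversalD[OF tj that] .
      have "\<exists>!x. x \<in> Ws ! j \<inter> (D \<union> N)" by (rule one) simp
      then obtain w where "w \<in> Ws ! j \<inter> (D \<union> N)" "\<forall>x. x \<in> Ws ! j \<inter> (D \<union> N) \<longrightarrow> x = w"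
        by (rule ex1E)
      then have w: "w \<in> Ws ! j" "w \<in> D \<union> N" "\<And>x. x \<in> Ws ! j \<Longrightarrow> x \<in> D \<union> N \<Longrightarrow> x = w" by (iprover intro: IntI dest: IntD1 IntD2)+
      \<comment> \<open>The copy has a point in the box \<open>Q\<close> with side \<open>j\<close>
        enlarged to \<open>D \<union> N\<close>. If \<open>w\<close> lay in \<open>N\<close>,
        putting it in as coordinate \<open>j\<close> would give a point of the copy in
        \<open>Q\<close>, which \<open>S\<close> misses. So \<open>w\<close> lies in
        \<open>D\<close>, and the copy serves the original blocks.\<close>
      have "w \<notin> N"
      proof
        assume wN: "w \<in> N"
        have "Q[j := D \<union> N] ! i \<in> \<Lambda>[j := ?\<beta>] ! i" if "i < length \<Lambda>" for i
          using Q(1) that unfolding mem_listset by (cases "i = j") auto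
        then have "Q[j := D \<union> N] \<in> listset (\<Lambda>[j := ?\<beta>])" using Q(1) unfolding mem_listset by simp
        then obtain x where x: "x \<in> listset Ws" "x \<in> listset (Q[j := D \<union> N])"
          using transversal_meets[OF Ws(1)] by blast
        have lx: "length x = length Us" "length Q = length Us" using x(1) lW Q(1) len by (auto simp: mem_listset)
        have "x[j := w] ! i \<in> Ws ! i" "x[j := w] ! i \<in> Q ! i" if "i < length Us" for i
          using x that w(1) wN QN lx lW unfolding mem_listset by (cases "i = j"; force)+
        then have "x[j := w] \<in> listset Ws" "x[j := w] \<in> listset Q" using lx lW unfolding mem_listset by auto
        then show False using Ws(2) Q(2) by blast
      qed
      have "transversal (\<Lambda> ! j) (Ws ! j \<inter> V)"
        unfolding V_def
      proof (rule transversal_restrict)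
        fix B assume B: "B \<in> \<Lambda> ! j"
        show "\<exists>!x. x \<in> Ws ! j \<inter> B"
        proof (cases "B = D")
          case True
          have "w \<in> Ws ! j \<inter> B" using w(1,2) \<open>w \<notin> N\<close> True by simp
          moreover have "x = w" if "x \<in> Ws ! j \<inter> B" for x
            by (rule w(3)) (use that True in simp_all)
          ultimately show ?thesis by (rule ex1I)
        next
          case False
          then show ?thesis using one[of B] B by simp
        qed
      qed
      then show ?thesis using fin Ws by blast
    qed
  qed
qed

lemma listset_subset_listsetD:
  assumes "listset A \<subseteq> listset B" "\<And>X. X \<in> set A \<Longrightarrow> X \<noteq> {}"
  shows "length A = length B \<and> (\<forall>i<length A. A ! i \<subseteq> B ! i)"
proof -
  define x where "x = map (\<lambda>X. SOME x. x \<in> X) A"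
  have x: "x \<in> listset A" using assms(2) by (auto simp: x_def mem_listset some_in_eq)
  then have "x \<in> listset B" using assms(1) by blast
  then have len: "length A = length B" "length x = length A" using x by (auto simp: mem_listset)
  have "a \<in> B ! i" if "i < length A" "a \<in> A ! i" for i a
  proof -
    have "x[i := a] \<in> listset A" using x that by (auto simp: mem_listset nth_list_update)
    then have "x[i := a] \<in> listset B" using assms(1) by blast
    then show ?thesis using that len by (auto simp: mem_listset)
  qed
  then show ?thesis using len by blast
qed

text \<open>At one differing coordinate \<open>j\<close> the values of \<open>A\<close> and
  \<open>B\<close> become two blocks, at the other differing coordinates they share a block, and
  common sides are split into points. Each box chooses \<open>A\<close> or \<open>B\<close> at
  \<open>j\<close> and contains a point of the chosen cube, so this system is shattered. A copy
  consists of two cubes of \<open>S\<close> that differ only at \<open>j\<close>, with every other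
  side taken from \<open>A\<close> or \<open>B\<close>. The blocks may leave parts of the factors
  uncovered, hence \<open>ample_partial\<close>.\<close>

lemma ample_imp_galleries:
  assumes "ample Us S" "S \<subseteq> listset Us"
  shows "galleries S"
  unfolding galleries_def
proof (intro allI impI)
  fix A B assume "small_box A" "parallel A B" "listset A \<subseteq> S" "listset B \<subseteq> S" "A \<noteq> B"
  then show "\<exists>i<length A. A ! i \<noteq> B ! i \<and> listset (A[i := B ! i]) \<subseteq> S"
  proof (induction "hdist A B" arbitrary: B rule: less_induct)
    case (less B)
    have len: "length B = length A" using less.prems by (simp add: parallel_def)
    have sub: "length A = length Us \<and> (\<forall>i<length A. A ! i \<subseteq> Us ! i)"
      "length B = length Us \<and> (\<forall>i<length B. B ! i \<subseteq> Us ! i)"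
      using less.prems assms(2) small_box_finite small_box_par by (intro listset_subset_listsetD; blast)+
    have ne: "A ! i \<noteq> {}" "B ! i \<noteq> {}" if "i < length A" for i
      using that small_box_finite[OF less.prems(1)] small_box_finite[OF small_box_par[OF less.prems(1,2)]] len by auto
    obtain j where j: "j < length A" "A ! j \<noteq> B ! j" using less.prems(5) len by (metis nth_equalityI)
    have parallel: "A ! i = B ! i \<or> (\<exists>x y. A ! i = {x} \<and> B ! i = {y})" if "i < length A" for i
      using that less.prems(2) unfolding parallel_def by blast
    define \<Lambda> where "\<Lambda> = map (\<lambda>i. if A ! i = B ! i then (\<lambda>c. {c}) ` (A ! i) else
        if i = j then {A ! j, B ! j} else {A ! i \<union> B ! i}) [0..<length A]"
    have \<Lambda>: "length \<Lambda> = length A"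
      "\<Lambda> ! j = {A ! j, B ! j}"
      "\<And>i. i < length A \<Longrightarrow> A ! i = B ! i \<Longrightarrow> \<Lambda> ! i = (\<lambda>c. {c}) ` (A ! i)"
      "\<And>i. i < length A \<Longrightarrow> A ! i \<noteq> B ! i \<Longrightarrow> i \<noteq> j \<Longrightarrow> \<Lambda> ! i = {A ! i \<union> B ! i}"
      using j unfolding \<Lambda>_def by auto
    obtain x y where xy: "A ! j = {x}" "B ! j = {y}" "x \<noteq> y" using parallel[OF j(1)] j by auto
    have "strongly_shattered S \<Lambda>"
    proof (rule ample_partial[OF assms(1)])
      show "list_all2 (\<lambda>U \<alpha>. \<Union>\<alpha> \<subseteq> U \<and> disjoint \<alpha> \<and> {} \<notin> \<alpha> \<and> \<alpha> \<noteq> {}) Us \<Lambda>"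
        unfolding list_all2_conv_all_nth
      proof (intro conjI allI impI)
        fix i assume "i < length Us"
        then have i: "i < length A" using sub by simp
        consider "A ! i = B ! i" | "i = j" | "A ! i \<noteq> B ! i" "i \<noteq> j" by blast
        then have "\<Union>(\<Lambda> ! i) \<subseteq> Us ! i \<and> disjoint (\<Lambda> ! i) \<and> {} \<notin> \<Lambda> ! i \<and> \<Lambda> ! i \<noteq> {}"
        proof cases
          case 1
          then show ?thesis using \<Lambda>(3)[OF i 1] ne[OF i] sub i by (auto simp: pairwise_def disjnt_def)
        next
          case 2
          then show ?thesis using \<Lambda>(2) xy sub j len by (auto simp: pairwise_def disjnt_def)
        next
          case 3
          then show ?thesis using \<Lambda>(4)[OF i 3] ne[OF i] sub i len by (auto simp: pairwise_def disjnt_def)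
        qed
        then show "\<Union>(\<Lambda> ! i) \<subseteq> Us ! i" "disjoint (\<Lambda> ! i)" "{} \<notin> \<Lambda> ! i" "\<Lambda> ! i \<noteq> {}" by auto
      qed (use sub \<Lambda> in simp)
      show "shattered S \<Lambda>" unfolding shattered_def minor_subproduct_def
      proof
        fix Q assume "Q \<in> listset \<Lambda>"
        then have Q: "length Q = length A" "\<And>i. i < length A \<Longrightarrow> Q ! i \<in> \<Lambda> ! i" using \<Lambda>(1) by (auto simp: mem_listset)
        obtain C where C: "C = A \<or> C = B" "Q ! j = C ! j" using Q(2)[OF j(1)] \<Lambda>(2) by auto
        have "\<exists>c. c \<in> C ! i \<and> c \<in> Q ! i" if i: "i < length A" for i
        proof -
          consider "A ! i = B ! i" | "i = j" | "A ! i \<noteq> B ! i" "i \<noteq> j" by blast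
          then show ?thesis
          proof cases
            case 1
            then show ?thesis using \<Lambda>(3)[OF i 1] Q(2)[OF i] C(1) by auto
          next
            case 2
            then show ?thesis using C xy by auto
          next
            case 3
            then show ?thesis using \<Lambda>(4)[OF i 3] Q(2)[OF i] C(1) ne[OF i] by auto
          qed
        qed
        then obtain f where f: "\<And>i. i < length A \<Longrightarrow> f i \<in> C ! i \<and> f i \<in> Q ! i" by metis
        have "map f [0..<length A] \<in> listset C" "map f [0..<length A] \<in> listset Q"
          using f C(1) Q(1) len by (auto simp: mem_listset)
        then show "S \<inter> listset Q \<noteq> {}" using C(1) less.prems by blast
      qed
    qed
    then obtain Ws where Ws: "list_all2 transversal \<Lambda> Ws" "listset Ws \<subseteq> S" unfolding strongly_shattered_iff by blast
    have lW: "length Ws = length A" using Ws(1) \<Lambda>(1) by (simp add: list_all2_lengthD)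
    have tr: "transversal (\<Lambda> ! i) (Ws ! i)" if "i < length A" for i
      using that list_all2_nthD[OF Ws(1)] \<Lambda>(1) by simp
    have "Ws ! j \<subseteq> {x, y}" "\<exists>z. z \<in> Ws ! j \<inter> {x}" "\<exists>z. z \<in> Ws ! j \<inter> {y}"
      using tr[OF j(1)] xy unfolding \<Lambda>(2) transversal_def by auto
    then have Wj: "A ! j \<subseteq> Ws ! j" "B ! j \<subseteq> Ws ! j" using xy by auto
    have Wi: "Ws ! i = A ! i \<or> Ws ! i = B ! i" if i: "i < length A" "i \<noteq> j" for i
    proof (cases "A ! i = B ! i")
      case True
      then show ?thesis using tr[OF i(1)] unfolding \<Lambda>(3)[OF i(1) True] transversal_def by auto
    next
      case False
      obtain u v where uv: "A ! i = {u}" "B ! i = {v}" using parallel[OF i(1)] False by blast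
      have "Ws ! i \<subseteq> {u, v}" "\<exists>!z. z \<in> Ws ! i \<inter> {u, v}"
        using tr[OF i(1)] unfolding \<Lambda>(4)[OF i(1) False i(2)] transversal_def uv by auto
      then show ?thesis unfolding uv by auto
    qed
    define C where "C = Ws[j := A ! j]"
    have "C ! i = A ! i \<or> C ! i = B ! i" if "i < length A" for i
      using Wi[OF that] lW that unfolding C_def by (cases "i = j") simp_all
    then have C: "between A C B" using lW len unfolding between_def by (simp add: C_def)
    have CS: "listset C \<subseteq> S"
      using listset_update_subset[of j Ws "A ! j"] Wj Ws(2) j lW unfolding C_def by auto
    have DS: "listset (C[j := B ! j]) \<subseteq> S"
      using listset_update_subset[of j Ws "B ! j"] Wj Ws(2) j lW unfolding C_def by auto
    show ?case
    \<comment> \<open>If \<open>C\<close> is \<open>A\<close>, its translate at \<open>j\<close> is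
      the desired step. Otherwise \<open>C\<close> is closer to \<open>A\<close> than
      \<open>B\<close> is, as it differs from \<open>B\<close> at \<open>j\<close>, and a step
      towards \<open>C\<close> is one towards \<open>B\<close>.\<close>
    proof (cases "C = A")
      case True
      then show ?thesis using DS j by blast
    next
      case False
      have "C \<noteq> B" using j lW unfolding C_def by auto
      then have "hdist A C < hdist A B" using hdist_less[OF C] by blast
      then obtain i where i: "i < length A" "A ! i \<noteq> C ! i" "listset (A[i := C ! i]) \<subseteq> S"
        using less.hyps[of C] less.prems CS False parallel_btw[OF less.prems(2) C] by blast
      have "C ! i = B ! i" using i(1,2) C unfolding between_def by force
      then have "A ! i \<noteq> B ! i" "listset (A[i := B ! i]) \<subseteq> S" using i by auto
      then show ?thesis using i(1) by blast
    qed
  qed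
qed

section \<open>A first-order test\<close>

text \<open>Meant for \<open>p\<close>, \<open>q\<close> antipodal in one cube and \<open>r\<close>,
  \<open>s\<close> the corresponding antipodes of a parallel one; keeping the order of the antipodes
  makes \<open>r\<close> the translate of \<open>p\<close>.\<close>

definition parallel4 :: "'a list \<Rightarrow> 'a list \<Rightarrow> 'a list \<Rightarrow> 'a list \<Rightarrow> bool" where
  "parallel4 p q r s \<longleftrightarrow> (\<forall>i<length p. p ! i = q ! i \<and> r ! i = s ! i \<or> p ! i = r ! i \<and> q ! i = s ! i)"

text \<open>With \<open>p\<close> as origin, the cube spanned by \<open>p\<close> and \<open>q\<close> is a vector space over the field with two
  elements, and \<open>w\<close> below is the sum of \<open>t\<close> and \<open>u\<close>.  In an isometric set a subspace containing \<open>p\<close> and \<open>q\<close>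
  contains every unit vector and hence is the whole cube, so that no counting is needed to recognize
  cubes.\<close>

definition affine :: "'a list set \<Rightarrow> 'a list \<Rightarrow> 'a list \<Rightarrow> bool" where
  "affine S p q \<longleftrightarrow> (\<forall>t\<in>S. between p t q \<longrightarrow> (\<forall>u\<in>S. between p u q \<longrightarrow> (\<exists>w\<in>S. between p w q \<and>
     (\<forall>i<length p. if u ! i = p ! i then w ! i = t ! i else w ! i \<noteq> t ! i))))"

text \<open>The point \<open>c\<close> is a neighbour of \<open>p\<close> in the direction of
  \<open>r\<close>, and \<open>w\<close> is the translate of \<open>t\<close> along the edge from
  \<open>p\<close> to \<open>c\<close>. Once the cube of \<open>p\<close> and \<open>q\<close> is
  known to lie in \<open>S\<close>, its vertices \<open>t\<close> are all reached by quantifying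
  over \<open>S\<close>.\<close>

definition step :: "'a list set \<Rightarrow> 'a list \<Rightarrow> 'a list \<Rightarrow> 'a list \<Rightarrow> bool" where
  "step S p q r \<longleftrightarrow> (\<exists>c\<in>S. between p c r \<and> c \<noteq> p \<and> hdist p c \<le> 1 \<and>
     (\<forall>t\<in>S. between p t q \<longrightarrow>
       (\<exists>w\<in>S. \<forall>i<length p. if c ! i = p ! i then w ! i = t ! i else w ! i = c ! i)))"

definition ample_test :: "'a list set \<Rightarrow> bool" where
  "ample_test S \<longleftrightarrow> (\<forall>p\<in>S. \<forall>q\<in>S. \<forall>r\<in>S. \<forall>s\<in>S.
     parallel4 p q r s \<longrightarrow> p \<noteq> r \<longrightarrow> affine S p q \<longrightarrow> affine S r s \<longrightarrow> step S p q r)"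

section \<open>Recognition of cubes by closure under sums\<close>

lemma affine_if_subcube:
  assumes "listset (subcube p q) \<subseteq> S" "length p = length q"
  shows "affine S p q"
  unfolding affine_def
proof (intro ballI impI)
  fix t u assume tu: "between p t q" "between p u q"
  \<comment> \<open>The sum of \<open>t\<close> and \<open>u\<close> with origin \<open>p\<close>:
    where both differ from \<open>p\<close>, they cancel.\<close>
  define w where "w = map (\<lambda>i. if u ! i = p ! i then t ! i else if t ! i = p ! i then q ! i else p ! i) [0..<length p]"
  have len: "length t = length p" "length u = length p" "length q = length p" using tu by (auto simp: between_def)
  have w: "(w ! i = p ! i \<or> w ! i = q ! i) \<and> (if u ! i = p ! i then w ! i = t ! i else w ! i \<noteq> t ! i)" if "i < length p" for i
  proof -
    have "t ! i = p ! i \<or> t ! i = q ! i" "u ! i = p ! i \<or> u ! i = q ! i" using tu that unfolding between_def by blast+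
    then show ?thesis using that unfolding w_def by auto
  qed
  then have "between p w q" using len unfolding between_def by (simp add: w_def)
  then show "\<exists>w\<in>S. between p w q \<and> (\<forall>i<length p. if u ! i = p ! i then w ! i = t ! i else w ! i \<noteq> t ! i)"
    using w assms mem_subcube[OF assms(2), of w] by blast
qed

lemma galleries_step_point:
  assumes "galleries S" "x \<in> S" "y \<in> S" "length x = length y" "x \<noteq> y"
  shows "\<exists>i<length x. x ! i \<noteq> y ! i \<and> x[i := y ! i] \<in> S"
proof -
  let ?s = "map (\<lambda>u. {u :: 'a})"
  have ls: "listset (?s z) = {z}" for z by (rule listset_singletons)
  have "small_box (?s x)" unfolding small_box_def by auto
  moreover have "parallel (?s x) (?s y)" using assms(4) by (auto simp: parallel_def)
  moreover have "?s x \<noteq> ?s y" using ls assms(5) by (metis singleton_inject)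
  ultimately obtain i where i: "i < length (?s x)" "?s x ! i \<noteq> ?s y ! i" "listset ((?s x)[i := ?s y ! i]) \<subseteq> S"
    using galleriesD[OF assms(1), of "?s x" "?s y"] assms ls by auto
  then have "(?s x)[i := ?s y ! i] = ?s (x[i := y ! i])" using assms(4) by (simp add: map_update)
  then have "x[i := y ! i] \<in> S" using i(3) ls by auto
  then show ?thesis using i assms(4) by auto
qed

text \<open>A shortest path in \<open>S\<close> from \<open>u\<close> to \<open>q\<close> stays
  between \<open>p\<close> and \<open>q\<close> and has to change coordinate \<open>i\<close> at
  some point; \<open>z\<close> is the vertex just before. The result is an edge of \<open>S\<close>
  in direction \<open>i\<close>.\<close>

lemma flip_edge:
  assumes "galleries S" "q \<in> S" "p ! i \<noteq> q ! i" "i < length p"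
  shows "u \<in> S \<Longrightarrow> between p u q \<Longrightarrow> u ! i = p ! i \<Longrightarrow> \<exists>z\<in>S. between p z q \<and> z ! i = p ! i \<and> z[i := q ! i] \<in> S"
proof (induction "hdist u q" arbitrary: u rule: less_induct)
  case less
  have len: "length u = length q" "length u = length p" using less.prems by (auto simp: between_def)
  have "u \<noteq> q" using less.prems assms by auto
  then obtain l where l: "l < length u" "u ! l \<noteq> q ! l" "u[l := q ! l] \<in> S"
    using galleries_step_point[OF assms(1) less.prems(1) assms(2) len(1)] by blast
  show ?case
  proof (cases "l = i")
    case True
    then show ?thesis using l less.prems by blast
  next
    case False
    have u: "between u (u[l := q ! l]) q" "u[l := q ! l] \<noteq> u"
      using between_update[of q u l] l len by (auto dest: arg_cong[of _ _ "\<lambda>x. x ! l"])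
    have "between p (u[l := q ! l]) q"
      using between_convex[OF less.prems(2) between_refl(2) u(1)] len by simp
    moreover have "u[l := q ! l] ! i = p ! i" using False less.prems by simp
    ultimately show ?thesis using less.hyps[OF hdist_less'[OF u] l(3)] by blast
  qed
qed

lemma subcube_if_affine:
  assumes "galleries S" "affine S p q" "p \<in> S" "q \<in> S" "length p = length q"
    and len: "\<And>x. x \<in> S \<Longrightarrow> length x = length p"
  shows "listset (subcube p q) \<subseteq> S"
proof -
  have sum: "\<exists>w\<in>S. between p w q \<and> (\<forall>i<length p. if u ! i = p ! i then w ! i = t ! i else w ! i \<noteq> t ! i)"
    if "t \<in> S" "between p t q" "u \<in> S" "between p u q" for t u
    using assms(2) that unfolding affine_def by blast
  have unit: "p[i := q ! i] \<in> S" if i: "i < length p" "p ! i \<noteq> q ! i" for i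
  proof -
    have "between p p q" using assms(5) by (simp add: between_def)
    then obtain z where z: "z \<in> S" "between p z q" "z ! i = p ! i" "z[i := q ! i] \<in> S"
      using flip_edge[OF assms(1,4) i(2,1) assms(3)] by blast
    have lz: "length z = length p" using z by (simp add: between_def)
    have "between p (z[i := q ! i]) q"
      by (rule between_convex[OF z(2) between_refl(2) between_update[of q z i]]) (use lz assms(5) in simp_all)
    then obtain w where w: "w \<in> S" "between p w q"
      "\<forall>k<length p. if z[i := q ! i] ! k = p ! k then w ! k = z ! k else w ! k \<noteq> z ! k"
      using sum[OF z(1,2) z(4)] by blast
    \<comment> \<open>The two ends of an edge in direction \<open>i\<close> sum to the unit vector
      of that direction.\<close>
    have "w = p[i := q ! i]"
    proof (rule nth_equalityI)
      fix k assume "k < length w"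
      then have k: "k < length p" using w(2) by (simp add: between_def)
      have c: "w ! k = p ! k \<or> w ! k = q ! k" "z ! k = p ! k \<or> z ! k = q ! k" using w(2) z(2) k unfolding between_def by blast+
      show "w ! k = p[i := q ! i] ! k"
      proof (cases "k = i")
        case True
        then have "w ! i \<noteq> z ! i" using w(3) k lz i by auto
        then show ?thesis using True c z(3) k by auto
      next
        case False
        then show ?thesis using w(3)[rule_format, OF k] c by (auto split: if_splits)
      qed
    qed (use w(2) in \<open>simp add: between_def\<close>)
    then show ?thesis using w by simp
  qed
  have "x \<in> S" if "between p x q" for x
    using that
  proof (induction "hdist p x" arbitrary: x rule: less_induct)
    case less
    show ?case
    proof (cases "x = p")
      case False
      have lx: "length x = length p" using less.prems by (simp add: between_def)
      obtain i where i: "i < length p" "x ! i \<noteq> p ! i" using False lx by (metis nth_equalityI)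
      have xq: "x ! i = q ! i" using less.prems i unfolding between_def by blast
      let ?y = "x[i := p ! i]"
      have y: "between p ?y x" using i lx by (auto simp: between_def nth_list_update)
      have yne: "?y \<noteq> x" using i lx by (metis nth_list_update_eq)
      have yq: "between p ?y q" using between_trans[OF less.prems y] .
      have yS: "?y \<in> S" using less.hyps[OF hdist_less[OF y yne] yq] .
      have "between p (p[i := q ! i]) q" using between_update assms(5) by metis
      then obtain w where w: "w \<in> S" "between p w q"
        "\<forall>k<length p. if p[i := q ! i] ! k = p ! k then w ! k = ?y ! k else w ! k \<noteq> ?y ! k"
        using sum[OF yS yq unit[OF i(1)]] i xq by metis
      \<comment> \<open>Resetting coordinate \<open>i\<close> of \<open>x\<close> to the origin and
        then adding the unit vector of direction \<open>i\<close> gives \<open>x\<close>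
        back.\<close>
      have "w = x"
      proof (rule nth_equalityI)
        fix k assume "k < length w"
        then have k: "k < length p" using w(2) by (simp add: between_def)
        show "w ! k = x ! k"
        proof (cases "k = i")
          case True
          then have "w ! i \<noteq> p ! i" using w(3) k lx i xq by auto
          moreover have "w ! i = p ! i \<or> w ! i = q ! i" using w(2) i unfolding between_def by blast
          ultimately show ?thesis using True xq by auto
        next
          case False
          then show ?thesis using w(3)[rule_format, OF k] by simp
        qed
      qed (use w(2) lx in \<open>simp add: between_def\<close>)
      then show ?thesis using w by simp
    qed (use assms(3) in simp)
  qed
  then show ?thesis using mem_subcube[OF assms(5)] by blast
qed

section \<open>Equivalence of the test with the gallery condition\<close>

lemma galleries_imp_ample_test:
  assumes "galleries S" and len: "\<And>x. x \<in> S \<Longrightarrow> length x = m"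
  shows "ample_test S"
  unfolding ample_test_def
proof (intro ballI impI)
  fix p q r s assume S: "p \<in> S" "q \<in> S" "r \<in> S" "s \<in> S"
    and parallel4: "parallel4 p q r s" and ne: "p \<noteq> r" and aff: "affine S p q" "affine S r s"
  have l: "length p = m" "length q = m" "length r = m" "length s = m" using S len by auto
  let ?A = "subcube p q" and ?B = "subcube r s"
  have A: "listset ?A \<subseteq> S" using subcube_if_affine[OF assms(1) aff(1)] S l len by simp
  have B: "listset ?B \<subseteq> S" using subcube_if_affine[OF assms(1) aff(2)] S l len by simp
  have pi: "p ! i = q ! i \<and> r ! i = s ! i \<or> p ! i = r ! i \<and> q ! i = s ! i" if "i < m" for i
    using parallel4 that l unfolding parallel4_def by blast
  have "small_box ?A" using l by (auto simp: small_box_def in_set_conv_nth, blast)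
  moreover have "parallel ?A ?B" unfolding parallel_def
  proof (intro conjI allI impI)
    fix i assume "i < length ?A"
    then show "?A ! i = ?B ! i \<or> (\<exists>x y. ?A ! i = {x} \<and> ?B ! i = {y})" using pi[of i] l by auto
  qed (simp add: l)
  moreover have "?A \<noteq> ?B"
  proof
    assume eq: "?A = ?B"
    have "p ! i = r ! i" if "i < m" for i
    proof -
      have "{p ! i, q ! i} = {r ! i, s ! i}" using that l nth_subcube eq by metis
      then show ?thesis using pi[OF that] by auto
    qed
    then show False using ne l by (metis nth_equalityI)
  qed
  ultimately obtain i where i: "i < length ?A" "?A ! i \<noteq> ?B ! i" "listset (?A[i := ?B ! i]) \<subseteq> S"
    using galleriesD[OF assms(1) _ _ A B] by blast
  have im: "i < m" using i l by simp
  \<comment> \<open>The second alternative of \<open>parallel4\<close> would make the sides equal,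
    so at \<open>i\<close> the first one holds and both cubes are constant there.\<close>
  have e: "p ! i = q ! i" "r ! i = s ! i" "p ! i \<noteq> r ! i" using pi[OF im] i(2) im l by auto
  have upd: "t[i := r ! i] \<in> S" if "between p t q" for t
  proof -
    have "t \<in> listset ?A" using that mem_subcube l by metis
    then have "t[i := r ! i] \<in> listset (?A[i := ?B ! i])" using im l
      by (simp add: mem_listset nth_list_update)
    then show ?thesis using i by blast
  qed
  show "step S p q r"
    unfolding step_def
  proof (rule bexI[of _ "p[i := r ! i]"], intro conjI ballI impI)
    show "p[i := r ! i] \<in> S" using upd[of p] l by (simp add: between_def)
    show "between p (p[i := r ! i]) r" using between_update l by metis
    show "p[i := r ! i] \<noteq> p" using e im l by (metis nth_list_update_eq)
    have "{k. k < length p \<and> p ! k \<noteq> p[i := r ! i] ! k} \<subseteq> {i}"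
      using nth_list_update_neq[of i _ p] by fastforce
    then have "card {k. k < length p \<and> p ! k \<noteq> p[i := r ! i] ! k} \<le> card {i}" by (intro card_mono) auto
    then show "hdist p (p[i := r ! i]) \<le> 1" unfolding hdist_def by simp
    fix t assume "t \<in> S" "between p t q"
    then have "t[i := r ! i] \<in> S" using upd by blast
    moreover have "t[i := r ! i] ! k = (if p[i := r ! i] ! k = p ! k then t ! k else p[i := r ! i] ! k)"
      if "k < length p" for k
      using that e l \<open>between p t q\<close> by (cases "k = i") (auto simp: between_def)
    ultimately show "\<exists>w\<in>S. \<forall>k<length p. if p[i := r ! i] ! k = p ! k then w ! k = t ! k else w ! k = p[i := r ! i] ! k"
      by (intro bexI[of _ "t[i := r ! i]"]) (simp_all split: if_splits)
  qed
qed

lemma ample_test_imp_galleries: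
  assumes "ample_test S" and len: "\<And>x. x \<in> S \<Longrightarrow> length x = m"
  shows "galleries S"
  unfolding galleries_def
proof (intro allI impI)
  fix A B assume AB: "small_box A" "parallel A B" "listset A \<subseteq> S" "listset B \<subseteq> S" "A \<noteq> B"
  have "\<forall>i. \<exists>a b. i < length A \<longrightarrow> A ! i = {a, b}" using AB(1) unfolding small_box_def by (meson nth_mem)
  then obtain f g where fg: "\<And>i. i < length A \<Longrightarrow> A ! i = {f i, g i}" by metis
  define p where "p = map f [0..<length A]"
  define q where "q = map g [0..<length A]"
  \<comment> \<open>On common sides \<open>r\<close> and \<open>s\<close> repeat the order chosen
    for \<open>p\<close> and \<open>q\<close>, as \<open>parallel4\<close> demands; a differing side
    of \<open>B\<close> is a singleton, and \<open>the_elem\<close> returns its point.\<close>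
  define r where "r = map (\<lambda>i. if A ! i = B ! i then f i else the_elem (B ! i)) [0..<length A]"
  define s where "s = map (\<lambda>i. if A ! i = B ! i then g i else the_elem (B ! i)) [0..<length A]"
  have l: "length p = length A" "length q = length A" "length r = length A" "length s = length A" "length B = length A"
    using AB(2) unfolding p_def q_def r_def s_def parallel_def by auto
  have Ai: "A ! i = {p ! i, q ! i}" if "i < length A" for i using fg that unfolding p_def q_def by simp
  have Bi: "B ! i = {r ! i, s ! i} \<and> (p ! i = q ! i \<and> r ! i = s ! i \<or> p ! i = r ! i \<and> q ! i = s ! i) \<and>
     (A ! i \<noteq> B ! i \<longrightarrow> p ! i = q ! i \<and> p ! i \<noteq> r ! i)" if i: "i < length A" for i
  proof (cases "A ! i = B ! i")
    case True
    then show ?thesis using i fg unfolding p_def q_def r_def s_def by auto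
  next
    case False
    then obtain x y where xy: "A ! i = {x}" "B ! i = {y}" using AB(2) i unfolding parallel_def by blast
    then show ?thesis using False i fg[OF i] unfolding p_def q_def r_def s_def by auto
  qed
  have Aeq: "A = subcube p q" using Ai l by (intro nth_equalityI) auto
  have Beq: "B = subcube r s" using Bi l by (intro nth_equalityI) auto
  have S: "p \<in> S" "q \<in> S" "r \<in> S" "s \<in> S"
    using AB(3,4) Ai Bi l by (auto simp: mem_listset subset_iff)
  then have m: "m = length A" using len l by metis
  have "parallel4 p q r s" using Bi l unfolding parallel4_def by auto
  moreover have "p \<noteq> r"
  proof
    assume "p = r"
    then have "A ! i = B ! i" if "i < length A" for i using Bi[OF that] by blast
    then show False using AB(5) l by (metis nth_equalityI)
  qed
  moreover have "affine S p q" using affine_if_subcube Aeq AB(3) l by metis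
  moreover have "affine S r s" using affine_if_subcube Beq AB(4) l by metis
  ultimately have "step S p q r" using assms(1) S unfolding ample_test_def by blast
  then obtain c where c: "c \<in> S" "between p c r" "c \<noteq> p" "hdist p c \<le> 1"
    "\<And>t. t \<in> S \<Longrightarrow> between p t q \<Longrightarrow> \<exists>w\<in>S. \<forall>i<length p. if c ! i = p ! i then w ! i = t ! i else w ! i = c ! i"
    unfolding step_def by blast
  obtain i where i: "i < length A" "c ! i \<noteq> p ! i"
    using c(2,3) l unfolding between_def by (metis nth_equalityI)
  have ci: "c ! i = r ! i" using c(2) i l unfolding between_def by auto
  have ck: "c ! k = p ! k" if "k < length A" "k \<noteq> i" for k
  proof (rule ccontr)
    assume "c ! k \<noteq> p ! k"
    then have "{i, k} \<subseteq> {k. k < length p \<and> p ! k \<noteq> c ! k}" using i that l by auto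
    then have "card {i, k} \<le> hdist p c" unfolding hdist_def by (intro card_mono) auto
    then show False using c(4) that by simp
  qed
  have Ane: "A ! i \<noteq> B ! i" using Bi[OF i(1)] i ci Ai[OF i(1)] by auto
  have "x \<in> S" if x: "x \<in> listset (A[i := B ! i])" for x
  proof -
    have lx: "length x = length A" using x by (simp add: mem_listset)
    have xk: "x ! k \<in> A[i := B ! i] ! k" if "k < length A" for k using x that by (simp add: mem_listset)
    have xi: "x ! i = r ! i" using xk[OF i(1)] Bi[OF i(1)] Ane i Ai[OF i(1)] by auto
    \<comment> \<open>The point \<open>x\<close> translated back into \<open>A\<close>. The test
      provides the translate of \<open>t\<close> along the edge from \<open>p\<close> to
      \<open>c\<close>, which can only be \<open>x\<close>.\<close>
    define t where "t = x[i := p ! i]"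
    have "t ! k \<in> A ! k" if "k < length A" for k
      using xk[OF that] Ai[OF that] that lx unfolding t_def by (cases "k = i") auto
    then have tA: "t \<in> listset A" using lx by (simp add: mem_listset t_def)
    then have "between p t q" using mem_subcube Aeq l by metis
    then obtain w where w: "w \<in> S" "\<forall>k<length p. if c ! k = p ! k then w ! k = t ! k else w ! k = c ! k"
      using c(5) tA AB(3) by blast
    have "w = x"
    proof (rule nth_equalityI)
      show lw: "length w = length x" using len[OF w(1)] m lx by simp
      fix k assume "k < length w"
      then have k: "k < length A" using lw lx by simp
      show "w ! k = x ! k"
      proof (cases "k = i")
        case True
        then show ?thesis using w(2) k l i(2) ci xi by auto
      next
        case False
        then show ?thesis using w(2) k l ck[OF k False] by (simp add: t_def)
      qed
    qed
    then show ?thesis using w by simp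
  qed
  then show "\<exists>i<length A. A ! i \<noteq> B ! i \<and> listset (A[i := B ! i]) \<subseteq> S" using i(1) Ane by blast
qed

section \<open>Compiling formulas to WHILE programs\<close>

text \<open>Exact step counts depend on the branches taken and on early exits, so only upper bounds
  are propagated.\<close>

definition exec_le :: "com \<Rightarrow> 'a state \<Rightarrow> nat \<Rightarrow> 'a state \<Rightarrow> bool" where
  "exec_le c s T s' \<longleftrightarrow> (\<exists>t\<le>T. exec c s t s')"

lemma exec_le_mono: "exec_le c s T s' \<Longrightarrow> T \<le> U \<Longrightarrow> exec_le c s U s'"
  unfolding exec_le_def by (meson order_trans)

lemma exec_le_Skip: "exec_le Skip s 1 s"
  unfolding exec_le_def using exec.Skip by blast

lemma exec_le_Assign:
  assumes "1 + cost e \<le> T" "s' = s(x := eval_expr e s)"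
  shows "exec_le (Assign x e) s T s'"
  unfolding exec_le_def using assms exec.Assign by blast

lemma exec_le_Seq:
  assumes "exec_le c s T s'" "exec_le d s' U s''"
  shows "exec_le (Seq c d) s (1 + T + U) s''"
proof -
  obtain t u where "t \<le> T" "exec c s t s'" "u \<le> U" "exec d s' u s''"
    using assms unfolding exec_le_def by blast
  then have "exec (Seq c d) s (1 + t + u) s''" "1 + t + u \<le> 1 + T + U" using exec.Seq by auto
  then show ?thesis unfolding exec_le_def by blast
qed

lemma exec_le_Cond:
  assumes "eval_expr e s \<noteq> Leaf \<Longrightarrow> exec_le c s T s'" "eval_expr e s = Leaf \<Longrightarrow> exec_le d s T s'"
  shows "exec_le (Cond e c d) s (1 + cost e + T) s'"
proof (cases "eval_expr e s = Leaf")
  case True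
  then obtain t where "t \<le> T" "exec d s t s'" using assms(2) unfolding exec_le_def by blast
  then have "exec (Cond e c d) s (1 + cost e + t) s'" "1 + cost e + t \<le> 1 + cost e + T"
    using exec.Cond_false[OF True] by auto
  then show ?thesis unfolding exec_le_def by blast
next
  case False
  then obtain t where "t \<le> T" "exec c s t s'" using assms(1) unfolding exec_le_def by blast
  then have "exec (Cond e c d) s (1 + cost e + t) s'" "1 + cost e + t \<le> 1 + cost e + T"
    using exec.Cond_true[OF False] by auto
  then show ?thesis unfolding exec_le_def by blast
qed

lemma exec_le_While_false:
  "eval_expr e s = Leaf \<Longrightarrow> exec_le (While e c) s (1 + cost e) s"
  unfolding exec_le_def using exec.While_false by blast

lemma exec_le_While_true:
  assumes "eval_expr e s \<noteq> Leaf" "exec_le c s T s'" "exec_le (While e c) s' U s''"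
  shows "exec_le (While e c) s (1 + cost e + T + U) s''"
proof -
  obtain t u where "t \<le> T" "exec c s t s'" "u \<le> U" "exec (While e c) s' u s''"
    using assms unfolding exec_le_def by blast
  then have "exec (While e c) s (1 + cost e + t + u) s''" "1 + cost e + t + u \<le> 1 + cost e + T + U"
    using exec.While_true[OF assms(1)] by auto
  then show ?thesis unfolding exec_le_def by blast
qed

text \<open>Variables of formulas are de Bruijn levels, indexing the list \<open>\<rho>\<close> of tuples chosen so far;
  \<open>Gt d \<beta>\<close> says that \<open>\<beta>\<close> holds at more than \<open>d\<close> coordinates.\<close>

datatype bformula = Eq nat nat | Nor bformula bformula

datatype formula = Gt nat bformula | Neg formula | Conj formula formula | Forall formula

fun holds_at :: "bformula \<Rightarrow> (nat \<Rightarrow> 'a) \<Rightarrow> bool" where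
  "holds_at (Eq v w) f \<longleftrightarrow> f v = f w"
| "holds_at (Nor a b) f \<longleftrightarrow> \<not> holds_at a f \<and> \<not> holds_at b f"

fun wf_bformula :: "nat \<Rightarrow> bformula \<Rightarrow> bool" where
  "wf_bformula k (Eq v w) \<longleftrightarrow> v < k \<and> w < k"
| "wf_bformula k (Nor a b) \<longleftrightarrow> wf_bformula k a \<and> wf_bformula k b"

definition count :: "bformula \<Rightarrow> 'a list list \<Rightarrow> nat \<Rightarrow> nat" where
  "count \<beta> \<rho> m = card {j. j < m \<and> holds_at \<beta> (\<lambda>v. \<rho> ! v ! j)}"

fun holds :: "'a list list \<Rightarrow> formula \<Rightarrow> 'a list list \<Rightarrow> bool" where
  "holds xs (Gt d \<beta>) \<rho> \<longleftrightarrow> d < count \<beta> \<rho> (length (hd \<rho>))"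
| "holds xs (Neg \<phi>) \<rho> \<longleftrightarrow> \<not> holds xs \<phi> \<rho>"
| "holds xs (Conj \<phi> \<psi>) \<rho> \<longleftrightarrow> holds xs \<phi> \<rho> \<and> holds xs \<psi> \<rho>"
| "holds xs (Forall \<phi>) \<rho> \<longleftrightarrow> (\<forall>x\<in>set xs. holds xs \<phi> (\<rho> @ [x]))"

fun wf_formula :: "nat \<Rightarrow> formula \<Rightarrow> bool" where
  "wf_formula k (Gt d \<beta>) \<longleftrightarrow> 0 < k \<and> wf_bformula k \<beta>"
| "wf_formula k (Neg \<phi>) \<longleftrightarrow> wf_formula k \<phi>"
| "wf_formula k (Conj \<phi> \<psi>) \<longleftrightarrow> wf_formula k \<phi> \<and> wf_formula k \<psi>"
| "wf_formula k (Forall \<phi>) \<longleftrightarrow> wf_formula (Suc k) \<phi>"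

text \<open>Program variable 0 keeps the input and variable 1 holds results.  For the tuple of level \<open>v\<close> there
  are three more: the tuple, the rest of the input still to be tried for it, and its suffix during a
  scan of the coordinates.\<close>

definition tup :: "nat \<Rightarrow> nat" where "tup v = 3 * v + 2"
definition iter :: "nat \<Rightarrow> nat" where "iter v = 3 * v + 3"
definition head :: "nat \<Rightarrow> nat" where "head v = 3 * v + 4"

lemma vars_distinct [simp]:
  "tup v \<noteq> 0" "iter v \<noteq> 0" "head v \<noteq> 0" "tup v \<noteq> 1" "iter v \<noteq> 1" "head v \<noteq> 1"
  "tup v \<noteq> Suc 0" "iter v \<noteq> Suc 0" "head v \<noteq> Suc 0"
  "0 \<noteq> tup v" "0 \<noteq> iter v" "0 \<noteq> head v" "Suc 0 \<noteq> tup v" "Suc 0 \<noteq> iter v" "Suc 0 \<noteq> head v"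
  "tup v \<noteq> iter w" "tup v \<noteq> head w" "iter v \<noteq> head w" "iter w \<noteq> tup v" "head w \<noteq> tup v" "head w \<noteq> iter v"
  "tup v = tup w \<longleftrightarrow> v = w" "iter v = iter w \<longleftrightarrow> v = w" "head v = head w \<longleftrightarrow> v = w"
  unfolding tup_def iter_def head_def by presburger+

text \<open>\<^const>\<open>Same\<close> is a NOR on truth values, as it is false on inner nodes.\<close>

fun bexpr :: "bformula \<Rightarrow> expr" where
  "bexpr (Eq v w) = Same (Left (Var (head v))) (Left (Var (head w)))"
| "bexpr (Nor a b) = Same (bexpr a) (bexpr b)"

fun set_heads :: "(nat \<Rightarrow> expr) \<Rightarrow> nat \<Rightarrow> com" where
  "set_heads f 0 = Skip"
| "set_heads f (Suc k) = Seq (set_heads f k) (Assign (head k) (f k))"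

text \<open>The tuples have equal length, so the suffix of level 0 tells when all scans end.
  Variable 1 counts in unary, which reduces comparison with a constant to stripping cells.\<close>

definition scan_loop :: "bformula \<Rightarrow> nat \<Rightarrow> com" where
  "scan_loop \<beta> k = While (Var (head 0)) (Seq (Cond (bexpr \<beta>) (Assign 1 (Join Empty (Var 1))) Skip)
     (set_heads (\<lambda>v. Right (Var (head v))) k))"

text \<open>For \<open>Gt\<close>, stripping \<open>d\<close> cells leaves a nonempty tree iff the
  count exceeds \<open>d\<close>. For \<open>Neg\<close>, \<open>Same\<close> with
  \<open>Empty\<close> is true at \<open>Leaf\<close> only. In \<open>Forall\<close>, a
  counterexample empties \<open>iter k\<close>, which stops the loop with the false result still in
  variable 1.\<close>

fun compile :: "nat \<Rightarrow> formula \<Rightarrow> com" where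
  "compile k (Gt d \<beta>) = Seq (Seq (Assign 1 Empty) (Seq (set_heads (\<lambda>v. Var (tup v)) k) (scan_loop \<beta> k)))
     (Assign 1 ((Right ^^ d) (Var 1)))"
| "compile k (Neg \<phi>) = Seq (compile k \<phi>) (Assign 1 (Same (Var 1) Empty))"
| "compile k (Conj \<phi> \<psi>) = Seq (compile k \<phi>) (Cond (Var 1) (compile k \<psi>) Skip)"
| "compile k (Forall \<phi>) = Seq (Assign (iter k) (Var 0)) (Seq (Assign 1 (Join Empty Empty))
     (While (Var (iter k)) (Seq (Assign (tup k) (Left (Var (iter k)))) (Seq (compile (Suc k) \<phi>)
       (Cond (Var 1) (Assign (iter k) (Right (Var (iter k)))) (Assign (iter k) Empty))))))"

section \<open>Running time and correctness of compiled formulas\<close>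

definition scan_cost :: "bformula \<Rightarrow> nat \<Rightarrow> nat" where
  "scan_cost \<beta> k = 10 + cost (bexpr \<beta>) + 4 * k"

text \<open>The argument is the number of tuples plus the number of coordinates, a common bound for
  the rounds of a quantifier loop and of a scan. The 12 is the cost of one round of the quantifier
  loop apart from the compiled subformula.\<close>

fun bound :: "nat \<Rightarrow> formula \<Rightarrow> nat poly" where
  "bound k (Gt d \<beta>) = [:10 + d + 3 * k, scan_cost \<beta> k:]"
| "bound k (Neg \<phi>) = [:5:] + bound k \<phi>"
| "bound k (Conj \<phi> \<psi>) = [:5:] + bound k \<phi> + bound k \<psi>"
| "bound k (Forall \<phi>) = [:10:] + [:0, 1:] * ([:12:] + bound (Suc k) \<phi>)"

text \<open>The assignments run one after another but act simultaneously: \<open>f v\<close> reads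
  only variables of level \<open>v\<close>, which the assignments to lower levels have not
  touched.\<close>

lemma set_heads:
  assumes "\<And>v. cost (f v) = c"
    and "\<And>v s s'. s (tup v) = s' (tup v) \<Longrightarrow> s (head v) = s' (head v) \<Longrightarrow> eval_expr (f v) s = eval_expr (f v) (s' :: 'a state)"
  shows "\<exists>s'. exec_le (set_heads f k) (s :: 'a state) (1 + k * (2 + c)) s' \<and> (\<forall>v<k. s' (head v) = eval_expr (f v) s) \<and>
    (\<forall>x. (\<forall>v<k. x \<noteq> head v) \<longrightarrow> s' x = s x)"
proof (induction k)
  case 0
  have "exec_le (set_heads f 0) s (1 + 0 * (2 + c)) s" using exec_le_Skip[of s] by simp
  then show ?case by blast
next
  case (Suc k)
  then obtain s' where s': "exec_le (set_heads f k) s (1 + k * (2 + c)) s'"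
    "\<And>v. v < k \<Longrightarrow> s' (head v) = eval_expr (f v) s" "\<And>x. (\<forall>v<k. x \<noteq> head v) \<Longrightarrow> s' x = s x" by blast
  let ?s = "s'(head k := eval_expr (f k) s')"
  have "exec_le (set_heads f (Suc k)) s (1 + (1 + k * (2 + c)) + (1 + cost (f k))) ?s"
    unfolding set_heads.simps by (intro exec_le_Seq[OF s'(1)] exec_le_Assign) simp_all
  moreover have "eval_expr (f k) s' = eval_expr (f k) s"
    using s'(3) by (intro assms(2)) auto
  ultimately have "exec_le (set_heads f (Suc k)) s (1 + Suc k * (2 + c)) (s'(head k := eval_expr (f k) s))"
    by (simp add: assms(1) algebra_simps)
  moreover have "(s'(head k := eval_expr (f k) s)) (head v) = eval_expr (f v) s" if "v < Suc k" for v
    using s'(2)[of v] that by (cases "v = k") simp_all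
  moreover have "(s'(head k := eval_expr (f k) s)) x = s x" if "\<forall>v<Suc k. x \<noteq> head v" for x
    using s'(3)[of x] that by simp
  ultimately show ?case by blast
qed

lemma eval_bexpr:
  assumes "wf_bformula k \<beta>" "\<And>v. v < k \<Longrightarrow> left (s (head v)) = Atom (f v)"
  shows "eval_expr (bexpr \<beta>) s = (if holds_at \<beta> f then Node Leaf Leaf else Leaf)"
  using assms(1) by (induction \<beta>) (auto simp: assms(2))

lemma card_Suc_shift:
  "card {j. j < Suc m \<and> Q j} = (if Q 0 then 1 else 0) + card {j. j < m \<and> Q (Suc j)}"
proof -
  have "{j. j < Suc m \<and> Q j} = (if Q 0 then {0} else {}) \<union> Suc ` {j. j < m \<and> Q (Suc j)}"
    by (auto simp: less_Suc_eq_0_disj)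
  moreover have "card (Suc ` {j. j < m \<and> Q (Suc j)}) = card {j. j < m \<and> Q (Suc j)}"
    by (intro card_image) auto
  ultimately show ?thesis by (auto simp: card_insert_if)
qed

lemma count_Suc:
  assumes "\<And>y. y \<in> set \<rho> \<Longrightarrow> y \<noteq> []" "wf_bformula (length \<rho>) \<beta>"
  shows "count \<beta> \<rho> (Suc m) = (if holds_at \<beta> (\<lambda>v. hd (\<rho> ! v)) then 1 else 0) + count \<beta> (map tl \<rho>) m"
proof -
  \<comment> \<open>Well-formedness confines \<open>\<beta>\<close> to levels below
    \<open>length \<rho>\<close>, where indexing commutes with \<open>map tl\<close>.\<close>
  have cong: "holds_at \<beta> f = holds_at \<beta> g" if "\<And>v. v < length \<rho> \<Longrightarrow> f v = g v" for f g :: "nat \<Rightarrow> 'a"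
    using assms(2) by (induction \<beta>) (auto simp: that)
  have "holds_at \<beta> (\<lambda>v. \<rho> ! v ! Suc j) = holds_at \<beta> (\<lambda>v. map tl \<rho> ! v ! j)" for j
  proof (rule cong)
    fix v assume v: "v < length \<rho>"
    then obtain z zs where "\<rho> ! v = z # zs" using assms(1)[of "\<rho> ! v"] by (auto simp: neq_Nil_conv)
    then show "\<rho> ! v ! Suc j = map tl \<rho> ! v ! j" using v by simp
  qed
  moreover have "holds_at \<beta> (\<lambda>v. \<rho> ! v ! 0) = holds_at \<beta> (\<lambda>v. hd (\<rho> ! v))"
    by (rule cong) (use assms(1) in \<open>auto simp: hd_conv_nth\<close>)
  ultimately show ?thesis unfolding count_def card_Suc_shift by simp
qed

abbreviation unary :: "nat \<Rightarrow> 'a tree" where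
  "unary c \<equiv> (Node Leaf ^^ c) Leaf"

text \<open>The counter starts at an arbitrary \<open>c\<close> and the tuples are arbitrary, so
  that one round leads to the same claim for the tails and the updated counter.\<close>

lemma scan_loop:
  assumes "length \<rho> = k" "0 < k" "wf_bformula k \<beta>" "\<forall>y\<in>set \<rho>. length y = m"
    "\<forall>v<k. s (head v) = tree_of_list Atom (\<rho> ! v)" "s 1 = unary c"
  shows "\<exists>s'. exec_le (scan_loop \<beta> k) s (2 + m * scan_cost \<beta> k) s' \<and> s' 1 = unary (count \<beta> \<rho> m + c) \<and>
    (\<forall>x. x \<noteq> 1 \<longrightarrow> (\<forall>v<k. x \<noteq> head v) \<longrightarrow> s' x = s x)"
  using assms
proof (induction m arbitrary: \<rho> s c)
  case 0
  then have "\<rho> ! 0 = []" by (metis length_0_conv nth_mem)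
  moreover have "s (head 0) = tree_of_list Atom (\<rho> ! 0)" using 0(5,2) by blast
  ultimately have "s (head 0) = Leaf" by (simp add: tree_of_list_def)
  then have "exec_le (scan_loop \<beta> k) s (1 + cost (Var (head 0))) s"
    unfolding scan_loop_def by (intro exec_le_While_false) simp
  then have "exec_le (scan_loop \<beta> k) s (2 + 0 * scan_cost \<beta> k) s" by (rule exec_le_mono) simp
  moreover have "s 1 = unary (count \<beta> \<rho> 0 + c)" using 0(6) by (simp add: count_def)
  ultimately show ?case by blast
next
  case (Suc m)
  have ne: "y \<noteq> []" if "y \<in> set \<rho>" for y using Suc.prems(4) that by fastforce
  have hd: "s (head v) = Node (Atom (hd (\<rho> ! v))) (tree_of_list Atom (tl (\<rho> ! v)))" if "v < k" for v
  proof -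
    have "\<rho> ! v \<in> set \<rho>" using that Suc.prems(1) by simp
    then obtain z zs where "\<rho> ! v = z # zs" using ne[of "\<rho> ! v"] by (auto simp: neq_Nil_conv)
    then show ?thesis using Suc.prems(5) that by (simp add: tree_of_list_def)
  qed
  let ?b = "holds_at \<beta> (\<lambda>v. hd (\<rho> ! v))"
  let ?s1 = "if ?b then s(1 := Node Leaf (s 1)) else s"
  have ev: "eval_expr (bexpr \<beta>) s = (if ?b then Node Leaf Leaf else Leaf)"
    using Suc.prems(3) by (rule eval_bexpr) (simp add: hd)
  have "exec_le (Assign 1 (Join Empty (Var 1))) s 4 (s(1 := Node Leaf (s 1)))"
    by (rule exec_le_Assign) simp_all
  moreover have "exec_le Skip s 4 s" using exec_le_mono[OF exec_le_Skip, of 4] by simp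
  ultimately have 1: "exec_le (Cond (bexpr \<beta>) (Assign 1 (Join Empty (Var 1))) Skip) s (1 + cost (bexpr \<beta>) + 4) ?s1"
    using ev by (intro exec_le_Cond) auto
  obtain s2 where s2: "exec_le (set_heads (\<lambda>v. Right (Var (head v))) k) ?s1 (1 + k * (2 + 2)) s2"
    "\<And>v. v < k \<Longrightarrow> s2 (head v) = right (?s1 (head v))" "\<And>x. (\<forall>v<k. x \<noteq> head v) \<Longrightarrow> s2 x = ?s1 x"
    using set_heads[of "\<lambda>v. Right (Var (head v))" 2 k ?s1] by auto
  have "\<exists>s'. exec_le (scan_loop \<beta> k) s2 (2 + m * scan_cost \<beta> k) s' \<and>
      s' 1 = unary (count \<beta> (map tl \<rho>) m + ((if ?b then 1 else 0) + c)) \<and>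
      (\<forall>x. x \<noteq> 1 \<longrightarrow> (\<forall>v<k. x \<noteq> head v) \<longrightarrow> s' x = s2 x)"
  proof (rule Suc.IH)
    show "\<forall>y\<in>set (map tl \<rho>). length y = m" using Suc.prems(4) by auto
    show "\<forall>v<k. s2 (head v) = tree_of_list Atom (map tl \<rho> ! v)" using s2(2) hd Suc.prems(1) by auto
    have "s2 1 = ?s1 1" using s2(3) by auto
    then show "s2 1 = unary ((if ?b then 1 else 0) + c)" using Suc.prems(6) by simp
  qed (use Suc.prems in auto)
  then obtain s' where s': "exec_le (scan_loop \<beta> k) s2 (2 + m * scan_cost \<beta> k) s'"
      "s' 1 = unary (count \<beta> (map tl \<rho>) m + ((if ?b then 1 else 0) + c))"
      "\<And>x. x \<noteq> 1 \<Longrightarrow> (\<forall>v<k. x \<noteq> head v) \<Longrightarrow> s' x = s2 x" by blast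
  have "exec_le (scan_loop \<beta> k) s (1 + cost (Var (head 0)) + (1 + (1 + cost (bexpr \<beta>) + 4) + (1 + k * (2 + 2)))
      + (2 + m * scan_cost \<beta> k)) s'"
    unfolding scan_loop_def
    by (intro exec_le_While_true[OF _ exec_le_Seq[OF 1 s2(1)]] s'(1)[unfolded scan_loop_def])
      (use hd[of 0] Suc.prems(2) in simp)
  then have "exec_le (scan_loop \<beta> k) s (2 + Suc m * scan_cost \<beta> k) s'"
    by (rule exec_le_mono) (simp add: scan_cost_def)
  moreover have "s' 1 = unary (count \<beta> \<rho> (Suc m) + c)"
    using s'(2) count_Suc[of \<rho> \<beta> m] ne Suc.prems(1,3) by (simp add: ac_simps)
  moreover have "s' x = s x" if "x \<noteq> 1" "\<forall>v<k. x \<noteq> head v" for x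
    using s'(3) s2(3) that by auto
  ultimately show ?case by blast
qed

lemma right_unary: "(right ^^ d) (unary c :: 'a tree) \<noteq> Leaf \<longleftrightarrow> d < c"
proof (induction d arbitrary: c)
  case 0
  show ?case by (cases c) auto
next
  case (Suc d)
  show ?case
  proof (cases c)
    case 0
    \<comment> \<open>Since \<open>right Leaf\<close> is \<open>Leaf\<close>, stripping more cells
      than the counter has does no harm.\<close>
    have "(right ^^ n) Leaf = (Leaf :: 'a tree)" for n by (induction n) auto
    then have "(right ^^ Suc d) Leaf = (Leaf :: 'a tree)" .
    then show ?thesis using 0 by (simp del: funpow.simps(2))
  next
    case (Suc b)
    then have "right (unary c) = (unary b :: 'a tree)" by simp
    moreover have "(right ^^ Suc d) (unary c :: 'a tree) = (right ^^ d) (right (unary c))"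
      by (simp only: funpow_Suc_right[of d] o_apply)
    ultimately have "(right ^^ Suc d) (unary c :: 'a tree) = (right ^^ d) (unary b)" by (simp only:)
    then show ?thesis using Suc.IH[of b] \<open>c = Suc b\<close> by (metis Suc_less_eq)
  qed
qed

lemma eval_Right_pow: "eval_expr ((Right ^^ d) e) s = (right ^^ d) (eval_expr e s)"
  "cost ((Right ^^ d) e) = d + cost e"
  by (induction d) auto

text \<open>\<open>Inv\<close> collects what has to survive for the enclosing quantifiers. The time
  bound also covers the early exit, where a false body leaves \<open>Leaf\<close> in variable 1 and
  the loop puts \<open>Leaf\<close> into \<open>iter k\<close>.\<close>

lemma all_loop:
  assumes body: "\<And>s y. y \<in> set ys \<Longrightarrow> Inv s \<Longrightarrow> s (tup k) = tree_of_list Atom y \<Longrightarrow>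
      \<exists>s'. exec_le c s T s' \<and> Inv s' \<and> s' (iter k) = s (iter k) \<and> (s' 1 \<noteq> Leaf \<longleftrightarrow> Q y)"
    and Inv: "\<And>s t. Inv s \<Longrightarrow> Inv (s(iter k := t))" "\<And>s t. Inv s \<Longrightarrow> Inv (s(tup k := t))"
  shows "Inv s \<Longrightarrow> s (iter k) = tree_of_tuples ys \<Longrightarrow> s 1 \<noteq> Leaf \<Longrightarrow>
    \<exists>s'. exec_le (While (Var (iter k)) (Seq (Assign (tup k) (Left (Var (iter k)))) (Seq c
       (Cond (Var 1) (Assign (iter k) (Right (Var (iter k)))) (Assign (iter k) Empty))))) s (2 + length ys * (12 + T)) s' \<and>
     Inv s' \<and> (s' 1 \<noteq> Leaf \<longleftrightarrow> (\<forall>y\<in>set ys. Q y))"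
    (is "_ \<Longrightarrow> _ \<Longrightarrow> _ \<Longrightarrow> \<exists>s'. exec_le ?w s _ s' \<and> _")
  using body
proof (induction ys arbitrary: s)
  case Nil
  have "exec_le ?w s (1 + cost (Var (iter k))) s"
    by (rule exec_le_While_false) (use Nil in \<open>simp add: tree_of_tuples_def tree_of_list_def\<close>)
  then have "exec_le ?w s (2 + length [] * (12 + T)) s" by (rule exec_le_mono) simp
  then show ?case using Nil by (intro exI[of _ s]) auto
next
  case (Cons y ys)
  have it: "s (iter k) = Node (tree_of_list Atom y) (tree_of_tuples ys)"
    using Cons.prems(2) by (simp add: tree_of_tuples_def tree_of_list_def)
  let ?s1 = "s(tup k := tree_of_list Atom y)"
  have 1: "exec_le (Assign (tup k) (Left (Var (iter k)))) s 3 ?s1"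
    by (rule exec_le_Assign) (simp_all add: it)
  have "\<exists>s'. exec_le c ?s1 T s' \<and> Inv s' \<and> s' (iter k) = ?s1 (iter k) \<and> (s' 1 \<noteq> Leaf \<longleftrightarrow> Q y)"
    by (rule Cons.prems(4)[OF _ Inv(2)[OF Cons.prems(1)]]) simp_all
  moreover have "?s1 (iter k) = s (iter k)" by simp
  ultimately obtain s2 where s2: "exec_le c ?s1 T s2" "Inv s2" "s2 (iter k) = s (iter k)" "s2 1 \<noteq> Leaf \<longleftrightarrow> Q y"
    by metis
  let ?s3 = "s2(iter k := if s2 1 = Leaf then Leaf else tree_of_tuples ys)"
  have "exec_le (Assign (iter k) (Right (Var (iter k)))) s2 3 (s2(iter k := tree_of_tuples ys))"
    by (rule exec_le_Assign) (simp_all add: it s2(3))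
  moreover have "exec_le (Assign (iter k) Empty) s2 3 (s2(iter k := Leaf))"
    by (rule exec_le_Assign) simp_all
  ultimately have "exec_le (Cond (Var 1) (Assign (iter k) (Right (Var (iter k)))) (Assign (iter k) Empty)) s2 (1 + cost (Var 1) + 3) ?s3"
    by (intro exec_le_Cond) auto
  note 2 = exec_le_Seq[OF 1 exec_le_Seq[OF s2(1) this]]
  have inv3: "Inv ?s3" using Inv(1)[OF s2(2)] .
  show ?case
  proof (cases "s2 1 = Leaf")
    case True
    have "exec_le ?w ?s3 (1 + cost (Var (iter k))) ?s3"
      by (rule exec_le_While_false) (use True in simp)
    then have "exec_le ?w s (1 + cost (Var (iter k)) + (1 + 3 + (1 + T + (1 + cost (Var 1) + 3))) + (1 + cost (Var (iter k)))) ?s3"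
      by (intro exec_le_While_true[OF _ 2]) (simp_all add: it)
    then have "exec_le ?w s (2 + length (y # ys) * (12 + T)) ?s3" by (rule exec_le_mono) simp
    moreover have "?s3 1 \<noteq> Leaf \<longleftrightarrow> (\<forall>y\<in>set (y # ys). Q y)" using True s2(4) by simp
    ultimately show ?thesis using inv3 by blast
  next
    case False
    have "\<exists>s'. exec_le ?w ?s3 (2 + length ys * (12 + T)) s' \<and> Inv s' \<and> (s' 1 \<noteq> Leaf \<longleftrightarrow> (\<forall>y\<in>set ys. Q y))"
      by (rule Cons.IH[OF inv3]) (use False Cons.prems(4) in auto)
    then obtain s' where s': "exec_le ?w ?s3 (2 + length ys * (12 + T)) s'" "Inv s'" "s' 1 \<noteq> Leaf \<longleftrightarrow> (\<forall>y\<in>set ys. Q y)" by blast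
    have "exec_le ?w s (1 + cost (Var (iter k)) + (1 + 3 + (1 + T + (1 + cost (Var 1) + 3))) + (2 + length ys * (12 + T))) s'"
      by (intro exec_le_While_true[OF _ 2 s'(1)]) (simp add: it)
    then have "exec_le ?w s (2 + length (y # ys) * (12 + T)) s'" by (rule exec_le_mono) simp
    then show ?thesis using False s2(4) s' by (intro exI[of _ s']) auto
  qed
qed

text \<open>Compiled code has to preserve the input and, for the enclosing quantifiers, the current
  tuples and the lists still to be tried. The heads are scratch: each \<open>Gt\<close> reloads them
  from the tuples. At level \<open>Suc k\<close> the preserved variables include
  \<open>iter k\<close>, so the loop of \<open>Forall\<close> can continue after its body.\<close>

lemma compile_correct:
  assumes "wf_formula k \<phi>" "length \<rho> = k" "\<forall>y\<in>set \<rho>. length y = m" "\<forall>y\<in>set xs. length y = m"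
    "s 0 = tree_of_tuples xs" "\<forall>v<k. s (tup v) = tree_of_list Atom (\<rho> ! v)"
  shows "\<exists>s'. exec_le (compile k \<phi>) s (poly (bound k \<phi>) (length xs + m)) s' \<and>
     (s' 0 = s 0 \<and> (\<forall>v<k. s' (tup v) = s (tup v) \<and> s' (iter v) = s (iter v))) \<and> (s' 1 \<noteq> Leaf \<longleftrightarrow> holds xs \<phi> \<rho>)"
  using assms
proof (induction \<phi> arbitrary: k \<rho> s)
  case (Gt d \<beta>)
  let ?s1 = "s(1 := Leaf)"
  have 1: "exec_le (Assign 1 Empty) s 2 ?s1" by (rule exec_le_Assign) simp_all
  obtain s2 where s2: "exec_le (set_heads (\<lambda>v. Var (tup v)) k) ?s1 (1 + k * (2 + 1)) s2"
    "\<And>v. v < k \<Longrightarrow> s2 (head v) = s (tup v)" "\<And>x. (\<forall>v<k. x \<noteq> head v) \<Longrightarrow> s2 x = ?s1 x"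
    using set_heads[of "\<lambda>v. Var (tup v)" 1 k ?s1] by auto
  have s21: "s2 1 = unary 0" using s2(3)[of 1] by simp
  obtain s3 where s3: "exec_le (scan_loop \<beta> k) s2 (2 + m * scan_cost \<beta> k) s3" "s3 1 = unary (count \<beta> \<rho> m + 0)"
      "\<And>x. x \<noteq> 1 \<Longrightarrow> (\<forall>v<k. x \<noteq> head v) \<Longrightarrow> s3 x = s2 x"
    using scan_loop[of \<rho> k \<beta> m s2 0] Gt.prems s2(2) s21 by auto
  let ?s4 = "s3(1 := (right ^^ d) (s3 1))"
  have 4: "exec_le (Assign 1 ((Right ^^ d) (Var 1))) s3 (d + 2) ?s4"
    by (rule exec_le_Assign) (simp_all add: eval_Right_pow)
  have "exec_le (compile k (Gt d \<beta>)) s (1 + (1 + 2 + (1 + (1 + k * (2 + 1)) + (2 + m * scan_cost \<beta> k))) + (d + 2)) ?s4"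
    unfolding compile.simps by (intro exec_le_Seq[OF exec_le_Seq[OF 1 exec_le_Seq[OF s2(1) s3(1)]] 4])
  then have "exec_le (compile k (Gt d \<beta>)) s (poly (bound k (Gt d \<beta>)) (length xs + m)) ?s4"
    by (rule exec_le_mono) (simp add: algebra_simps)
  moreover have "?s4 x = s x" if "x \<noteq> 1" "\<forall>v<k. x \<noteq> head v" for x
    using s3(3)[OF that] s2(3)[OF that(2)] that by simp
  then have "?s4 0 = s 0 \<and> (\<forall>v<k. ?s4 (tup v) = s (tup v) \<and> ?s4 (iter v) = s (iter v))"
    by (simp del: fun_upd_apply)
  moreover have "length (hd \<rho>) = m" using Gt.prems by (cases \<rho>) auto
  then have "?s4 1 \<noteq> Leaf \<longleftrightarrow> holds xs (Gt d \<beta>) \<rho>" using s3(2) by (simp add: right_unary)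
  ultimately show ?case by blast
next
  case (Neg \<phi>)
  obtain s1 where s1: "exec_le (compile k \<phi>) s (poly (bound k \<phi>) (length xs + m)) s1"
     "s1 0 = s 0 \<and> (\<forall>v<k. s1 (tup v) = s (tup v) \<and> s1 (iter v) = s (iter v))" "s1 1 \<noteq> Leaf \<longleftrightarrow> holds xs \<phi> \<rho>"
    using Neg.IH[OF _ Neg.prems(2-6)] Neg.prems(1) unfolding wf_formula.simps by blast
  let ?s2 = "s1(1 := same (s1 1) Leaf)"
  have "exec_le (Assign 1 (Same (Var 1) Empty)) s1 4 ?s2"
    by (rule exec_le_Assign) simp_all
  note exec_le_Seq[OF s1(1) this]
  then have "exec_le (compile k (Neg \<phi>)) s (poly (bound k (Neg \<phi>)) (length xs + m)) ?s2"
    unfolding compile.simps by (rule exec_le_mono) simp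
  moreover have "same (s1 1) Leaf \<noteq> Leaf \<longleftrightarrow> s1 1 = Leaf" by (cases "s1 1") auto
  then have "?s2 1 \<noteq> Leaf \<longleftrightarrow> holds xs (Neg \<phi>) \<rho>" using s1(3) by auto
  moreover have "?s2 0 = s 0 \<and> (\<forall>v<k. ?s2 (tup v) = s (tup v) \<and> ?s2 (iter v) = s (iter v))"
    using s1(2) by simp
  ultimately show ?case by blast
next
  case (Conj \<phi> \<psi>)
  obtain s1 where s1: "exec_le (compile k \<phi>) s (poly (bound k \<phi>) (length xs + m)) s1"
     "s1 0 = s 0 \<and> (\<forall>v<k. s1 (tup v) = s (tup v) \<and> s1 (iter v) = s (iter v))" "s1 1 \<noteq> Leaf \<longleftrightarrow> holds xs \<phi> \<rho>"
    using Conj.IH(1)[OF _ Conj.prems(2-6)] Conj.prems(1) unfolding wf_formula.simps by blast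
  have s1prem: "s1 0 = tree_of_tuples xs" "\<forall>v<k. s1 (tup v) = tree_of_list Atom (\<rho> ! v)"
    using s1(2) Conj.prems(5,6) by auto
  obtain s2 where s2: "exec_le (compile k \<psi>) s1 (poly (bound k \<psi>) (length xs + m)) s2"
     "s2 0 = s1 0 \<and> (\<forall>v<k. s2 (tup v) = s1 (tup v) \<and> s2 (iter v) = s1 (iter v))" "s2 1 \<noteq> Leaf \<longleftrightarrow> holds xs \<psi> \<rho>"
    using Conj.IH(2)[OF _ Conj.prems(2-4) s1prem] Conj.prems(1) unfolding wf_formula.simps by blast
  let ?s3 = "if s1 1 = Leaf then s1 else s2"
  have "exec_le (Cond (Var 1) (compile k \<psi>) Skip) s1 (1 + cost (Var 1) + (1 + poly (bound k \<psi>) (length xs + m))) ?s3"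
    using exec_le_mono[OF s2(1)] exec_le_mono[OF exec_le_Skip[of s1]] by (intro exec_le_Cond) auto
  note exec_le_Seq[OF s1(1) this]
  then have "exec_le (compile k (Conj \<phi> \<psi>)) s (poly (bound k (Conj \<phi> \<psi>)) (length xs + m)) ?s3"
    unfolding compile.simps by (rule exec_le_mono) simp
  then show ?case using s1(2,3) s2(2,3) by (intro exI[of _ ?s3]) auto
next
  case (Forall \<phi>)
  let ?T = "poly (bound (Suc k) \<phi>) (length xs + m)"
  define Inv where "Inv s' \<longleftrightarrow> s' 0 = s 0 \<and> (\<forall>v<k. s' (tup v) = s (tup v) \<and> s' (iter v) = s (iter v))" for s'
  let ?s1 = "s(iter k := tree_of_tuples xs)"
  let ?s2 = "?s1(1 := Node Leaf Leaf)"
  have 1: "exec_le (Assign (iter k) (Var 0)) s 2 ?s1"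
    by (rule exec_le_Assign) (simp_all add: Forall.prems(5))
  have 2: "exec_le (Assign 1 (Join Empty Empty)) ?s1 4 ?s2"
    by (rule exec_le_Assign) simp_all
  let ?w = "While (Var (iter k)) (Seq (Assign (tup k) (Left (Var (iter k)))) (Seq (compile (Suc k) \<phi>)
       (Cond (Var 1) (Assign (iter k) (Right (Var (iter k)))) (Assign (iter k) Empty))))"
  have "\<exists>s'. exec_le ?w ?s2 (2 + length xs * (12 + ?T)) s' \<and> Inv s' \<and> (s' 1 \<noteq> Leaf \<longleftrightarrow> (\<forall>y\<in>set xs. holds xs \<phi> (\<rho> @ [y])))"
  proof (rule all_loop)
    fix t y assume y: "y \<in> set xs" and t: "Inv t" "t (tup k) = tree_of_list Atom y"
    have "\<exists>s'. exec_le (compile (Suc k) \<phi>) t ?T s' \<and>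
       (s' 0 = t 0 \<and> (\<forall>v<Suc k. s' (tup v) = t (tup v) \<and> s' (iter v) = t (iter v))) \<and> (s' 1 \<noteq> Leaf \<longleftrightarrow> holds xs \<phi> (\<rho> @ [y]))"
    proof (rule Forall.IH)
      show "\<forall>v<Suc k. t (tup v) = tree_of_list Atom ((\<rho> @ [y]) ! v)"
        using t Forall.prems(2,6) unfolding Inv_def by (auto simp: less_Suc_eq nth_append)
    qed (use Forall.prems y t in \<open>auto simp: Inv_def\<close>)
    then show "\<exists>s'. exec_le (compile (Suc k) \<phi>) t ?T s' \<and> Inv s' \<and> s' (iter k) = t (iter k) \<and> (s' 1 \<noteq> Leaf \<longleftrightarrow> holds xs \<phi> (\<rho> @ [y]))"
      using t(1) unfolding Inv_def by auto
  qed (auto simp: Inv_def)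
  then obtain s' where s': "exec_le ?w ?s2 (2 + length xs * (12 + ?T)) s'" "Inv s'" "s' 1 \<noteq> Leaf \<longleftrightarrow> (\<forall>y\<in>set xs. holds xs \<phi> (\<rho> @ [y]))" by blast
  have "exec_le (compile k (Forall \<phi>)) s (1 + 2 + (1 + 4 + (2 + length xs * (12 + ?T)))) s'"
    unfolding compile.simps by (rule exec_le_Seq[OF 1 exec_le_Seq[OF 2 s'(1)]])
  then have "exec_le (compile k (Forall \<phi>)) s (poly (bound k (Forall \<phi>)) (length xs + m)) s'"
    by (rule exec_le_mono) (simp add: algebra_simps)
  then show ?case using s'(2,3) unfolding Inv_def by (intro exI[of _ s']) auto
qed

theorem decides_holds:
  assumes "wf_formula 0 \<phi>" "\<forall>y\<in>set xs. length y = m"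
  shows "decides_within (Seq (compile 0 \<phi>) (Assign 0 (Var 1))) (tree_of_tuples xs)
    (poly (bound 0 \<phi> + [:3:]) (length xs + m)) (holds xs \<phi> [])"
proof -
  obtain s where s: "exec_le (compile 0 \<phi>) ((\<lambda>_. Leaf)(0 := tree_of_tuples xs)) (poly (bound 0 \<phi>) (length xs + m)) s"
      "s 1 \<noteq> Leaf \<longleftrightarrow> holds xs \<phi> []"
    using compile_correct[OF assms(1), of "[]" m xs "(\<lambda>_. Leaf)(0 := tree_of_tuples xs)"] assms(2) by auto
  have "exec_le (Assign 0 (Var 1)) s 2 (s(0 := s 1))" by (rule exec_le_Assign) simp_all
  then have "exec_le (Seq (compile 0 \<phi>) (Assign 0 (Var 1))) ((\<lambda>_. Leaf)(0 := tree_of_tuples xs))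
     (1 + poly (bound 0 \<phi>) (length xs + m) + 2) (s(0 := s 1))"
    by (rule exec_le_Seq[OF s(1)])
  then obtain t where "t \<le> 1 + poly (bound 0 \<phi>) (length xs + m) + 2"
    "exec (Seq (compile 0 \<phi>) (Assign 0 (Var 1))) ((\<lambda>_. Leaf)(0 := tree_of_tuples xs)) t (s(0 := s 1))"
    unfolding exec_le_def by blast
  then show ?thesis unfolding decides_within_def using s(2)
    by (intro exI[of _ t] exI[of _ "s(0 := s 1)"]) auto
qed

section \<open>The decision procedure\<close>

definition bnot :: "bformula \<Rightarrow> bformula" where "bnot a = Nor a a"
definition bor :: "bformula \<Rightarrow> bformula \<Rightarrow> bformula" where "bor a b = bnot (Nor a b)"
definition band :: "bformula \<Rightarrow> bformula \<Rightarrow> bformula" where "band a b = Nor (bnot a) (bnot b)"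
definition bif :: "bformula \<Rightarrow> bformula \<Rightarrow> bformula \<Rightarrow> bformula" where "bif c a b = bor (band c a) (band (bnot c) b)"

definition Imp :: "formula \<Rightarrow> formula \<Rightarrow> formula" where "Imp \<phi> \<psi> = Neg (Conj \<phi> (Neg \<psi>))"
definition Exists :: "formula \<Rightarrow> formula" where "Exists \<phi> = Neg (Forall (Neg \<phi>))"
definition Somewhere :: "bformula \<Rightarrow> formula" where "Somewhere \<beta> = Gt 0 \<beta>"
definition Every :: "bformula \<Rightarrow> formula" where "Every \<beta> = Neg (Somewhere (bnot \<beta>))"
definition Between :: "nat \<Rightarrow> nat \<Rightarrow> nat \<Rightarrow> formula" where "Between x z y = Every (bor (Eq z x) (Eq z y))"

lemma holds_at_ops [simp]:
  "holds_at (bnot a) f \<longleftrightarrow> \<not> holds_at a f"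
  "holds_at (bor a b) f \<longleftrightarrow> holds_at a f \<or> holds_at b f"
  "holds_at (band a b) f \<longleftrightarrow> holds_at a f \<and> holds_at b f"
  "holds_at (bif c a b) f \<longleftrightarrow> (if holds_at c f then holds_at a f else holds_at b f)"
  by (auto simp: bnot_def bor_def band_def bif_def)

lemma holds_ops [simp]:
  "holds xs (Imp \<phi> \<psi>) \<rho> \<longleftrightarrow> (holds xs \<phi> \<rho> \<longrightarrow> holds xs \<psi> \<rho>)"
  "holds xs (Exists \<phi>) \<rho> \<longleftrightarrow> (\<exists>x\<in>set xs. holds xs \<phi> (\<rho> @ [x]))"
  "holds xs (Somewhere \<beta>) \<rho> \<longleftrightarrow> (\<exists>j<length (hd \<rho>). holds_at \<beta> (\<lambda>v. \<rho> ! v ! j))"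
  "holds xs (Every \<beta>) \<rho> \<longleftrightarrow> (\<forall>j<length (hd \<rho>). holds_at \<beta> (\<lambda>v. \<rho> ! v ! j))"
  by (auto simp: Imp_def Exists_def Every_def Somewhere_def count_def card_gt_0_iff)

text \<open>Levels 0 to 3 hold the four antipodes; here 4, 5 and 6 are the \<open>t\<close>,
  \<open>u\<close> and \<open>w\<close> of \<open>affine\<close>.\<close>

definition affine_formula :: "nat \<Rightarrow> nat \<Rightarrow> formula" where
  "affine_formula p q = Forall (Imp (Between p 4 q) (Forall (Imp (Between p 5 q) (Exists (Conj (Between p 6 q)
     (Every (bif (Eq 5 p) (Eq 6 4) (bnot (Eq 6 4)))))))))"

text \<open>Here 4, 5 and 6 are the \<open>c\<close>, \<open>t\<close> and \<open>w\<close> of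
  \<open>step\<close>. Tuples of equal length are distinct iff they differ somewhere, and the
  negated \<open>Gt 1\<close> bounds their distance by one; this is the only place where counting
  goes beyond existence.\<close>

definition step_formula :: formula where
  "step_formula = Exists (Conj (Between 0 4 2) (Conj (Somewhere (bnot (Eq 0 4))) (Conj (Neg (Gt 1 (bnot (Eq 0 4))))
     (Forall (Imp (Between 0 5 1) (Exists (Every (bif (Eq 4 0) (Eq 6 5) (Eq 6 4)))))))))"

definition ample_formula :: formula where
  "ample_formula = Forall (Forall (Forall (Forall (Imp (Every (bor (band (Eq 0 1) (Eq 2 3)) (band (Eq 0 2) (Eq 1 3))))
     (Imp (Somewhere (bnot (Eq 0 2))) (Imp (affine_formula 0 1) (Imp (affine_formula 2 3) step_formula)))))))"

lemma wf_ample_formula: "wf_formula 0 ample_formula"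
  unfolding ample_formula_def affine_formula_def step_formula_def Between_def Imp_def Exists_def Every_def Somewhere_def bnot_def bor_def band_def bif_def
  by simp

context
  fixes xs :: "'a list list" and m :: nat
  assumes len: "\<forall>x\<in>set xs. length x = m"
begin

lemma holds_Between:
  assumes "\<rho> \<noteq> []" "length (hd \<rho>) = m" "length (\<rho> ! x) = m" "length (\<rho> ! y) = m" "length (\<rho> ! z) = m"
  shows "holds xs (Between x z y) \<rho> \<longleftrightarrow> between (\<rho> ! x) (\<rho> ! z) (\<rho> ! y)"
  using assms by (simp add: Between_def between_def)

lemma holds_affine_formula:
  assumes "p \<in> set xs" "q \<in> set xs" "r \<in> set xs" "s \<in> set xs"
  shows "holds xs (affine_formula 0 1) [p, q, r, s] \<longleftrightarrow> affine (set xs) p q"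
    and "holds xs (affine_formula 2 3) [p, q, r, s] \<longleftrightarrow> affine (set xs) r s"
  using assms len by (simp_all add: affine_formula_def affine_def holds_Between)

lemma holds_step_formula:
  assumes "p \<in> set xs" "q \<in> set xs" "r \<in> set xs" "s \<in> set xs"
  shows "holds xs step_formula [p, q, r, s] \<longleftrightarrow> step (set xs) p q r"
proof -
  have "(\<exists>j<length p. p ! j \<noteq> c ! j) \<longleftrightarrow> c \<noteq> p" if "c \<in> set xs" for c
    using len assms(1) that by (metis nth_equalityI)
  moreover have "count (bnot (Eq 0 4)) [p, q, r, s, c] (length p) = hdist p c" for c
    by (simp add: count_def hdist_def)
  ultimately show ?thesis
    using assms len by (simp add: step_formula_def step_def holds_Between not_less cong: bex_cong)
qed

lemma holds_ample_formula: "holds xs ample_formula [] \<longleftrightarrow> ample_test (set xs)"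
proof -
  have "(\<exists>j<length p. p ! j \<noteq> r ! j) \<longleftrightarrow> p \<noteq> r" if "p \<in> set xs" "r \<in> set xs" for p r
    using len that by (metis nth_equalityI)
  then show ?thesis
    by (simp add: ample_formula_def ample_test_def holds_affine_formula holds_step_formula parallel4_def cong: ball_cong del: One_nat_def)
qed

end

lemma ample_iff_ample_test:
  assumes "\<forall>A\<in>set Us. finite A \<and> A \<noteq> {}" "S \<subseteq> listset Us"
  shows "ample Us S \<longleftrightarrow> ample_test S"
proof -
  have len: "length x = length Us" if "x \<in> S" for x using assms(2) that by (auto simp: mem_listset)
  have "ample Us S \<longleftrightarrow> galleries S" using ample_imp_galleries[OF _ assms(2)] galleries_imp_ample[of S Us] assms(1) by blast
  also have "\<dots> \<longleftrightarrow> ample_test S" using galleries_imp_ample_test ample_test_imp_galleries len by metis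
  finally show ?thesis .
qed

theorem corollary2:
  shows "\<exists>(c :: com) (p :: nat poly).
    \<forall>(Us :: 'a set list) (S :: 'a list set) (xs :: 'a list list).
      (\<forall>A\<in>set Us. finite A \<and> A \<noteq> {}) \<longrightarrow>
      S \<subseteq> listset Us \<longrightarrow>
      distinct xs \<and> set xs = S \<longrightarrow>
      decides_within c (tree_of_tuples xs) (poly p (card S + length Us)) (ample Us S)"
proof (intro exI allI impI)
  fix Us :: "'a set list" and S :: "'a list set" and xs :: "'a list list"
  assume Us: "\<forall>A\<in>set Us. finite A \<and> A \<noteq> {}" and S: "S \<subseteq> listset Us" and xs: "distinct xs \<and> set xs = S"
  have len: "\<forall>x\<in>set xs. length x = length Us" using S xs by (auto simp: mem_listset)
  have "card S = length xs" using xs distinct_card by blast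
  \<comment> \<open>The sentence speaks of the tuples in \<open>S\<close> alone, so the program can
    decide ampleness without being given the factors.\<close>
  moreover have "ample Us S \<longleftrightarrow> holds xs ample_formula []"
    using ample_iff_ample_test[OF Us S] holds_ample_formula[OF len] xs by simp
  ultimately show "decides_within (Seq (compile 0 ample_formula) (Assign 0 (Var 1))) (tree_of_tuples xs)
      (poly (bound 0 ample_formula + [:3:]) (card S + length Us)) (ample Us S)"
    using decides_holds[OF wf_ample_formula len] by simp
qed

end
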